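(* Let $\eta\in\mathfrak{M}_{\mathbb{C}}$. Then the following properties hold. 1. $\nu_\eta$ is a radial measure. 2. $T_{\nu_\eta}$ is a bounded radial operator on $A^2(\mathbb{D})$, and $R\,T_{\nu_\eta}R^\ast=M_{\gamma_\eta}$. 3. $\gamma_\eta$ is a bounded sequence. 4. $\varkappa_\eta$ and $\beta_\eta$ are bounded functions on $[0,1)$. 5. $\gamma_\eta$ is Lipschitz continuous with respect to $d_{\log}$.
   Context: $\mathbb{D}$ is the open unit disk, $\mathbb{T}$ the unit circle, $\mathbb{N}_0=\{0,1,2,\ldots\}$, $\lambda_{\mathbb{C}}$ the Lebesgue plane measure. $A^2(\mathbb{D})$ is the Bergman space of analytic functions in $L_2(\mathbb{D},\lambda_{\mathbb{C}})$ with the inherited inner product. For a (positive or complex) finite Borel measure $\eta$ on $[0,1)$ put $\varkappa_\eta(r)=\frac{2\,\eta([r,1))}{1-r^2}$ for $r\in[0,1)$; $\gamma_\eta(k)=2(k+1)\int_{[0,1)}r^{2k}\,\mathrm{d}\eta(r)$ for $k\in\mathbb{N}_0$; $\beta_\eta(a)=2(1-a^2)^2\int_{[0,1)}\frac{1+a^2r^2}{(1-a^2r^2)^3}\,\mathrm{d}\eta(r)$ for $a\in[0,1)$; and let $\nu_\eta$ be the pushforward of $\eta\times\lambda_{\mathbb{T}}$ under $[0,1)\times\mathbb{T}\to\mathbb{D}$, $(r,\tau)\mapsto r\tau$, where $\lambda_{\mathbb{T}}$ is the Haar measure on $\mathbb{T}$ with $\lambda_{\mathbb{T}}(\mathbb{T})=2\pi$.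 $\mathfrak{M}_{\mathbb{C}}$ is the set of all finite complex Borel measures $\eta$ on $[0,1)$ of the form $\eta=\eta_1-\eta_2+\mathrm{i}(\eta_3-\eta_4)$, where $\eta_1,\ldots,\eta_4$ are positive finite Borel measures on $[0,1)$ such that each $\varkappa_{\eta_j}$ is bounded. A (complex) Borel measure $\mu$ on $\mathbb{D}$ is radial if $\mu(\tau Z)=\mu(Z)$ for every $\tau\in\mathbb{T}$ and every Borel $Z\subseteq\mathbb{D}$. The Toeplitz operator is $(T_\mu f)(z)=\frac1\pi\int_{\mathbb{D}}\frac{f(w)}{(1-z\overline{w})^2}\,\mathrm{d}\mu(w)$. A bounded operator $S$ on $A^2(\mathbb{D})$ is radial if $S\rho_\tau=\rho_\tau S$ for every $\tau\in\mathbb{T}$, where $(\rho_\tau f)(z)=f(\tau^{-1}z)$. With $b_k(z)=\sqrt{\frac{k+1}{\pi}}\,z^k$ (an orthonormal basis of $A^2(\mathbb{D})$), $R\colon A^2(\mathbb{D})\to\ell_2(\mathbb{N}_0)$ is the isometric isomorphism $(Rf)(k)=\langle f,b_k\rangle$. For $\alpha\in\ell_\infty(\mathbb{N}_0)$, $M_\alpha c=(\alpha_kc_k)_{k\in\mathbb{N}_0}$ on $\ell_2(\mathbb{N}_0)$. The logarithmic distance on $\mathbb{N}_0$ is $d_{\log}(m,n)=|\log(m+1)-\log(n+1)|$. *)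

theory Defs
  imports "HOL-Complex_Analysis.Complex_Analysis"
begin

section \<open>Complex measures\<close>

text \<open>
  A complex measure on the measurable space \<open>M\<close> is a set function whose values matter only on
  \<open>sets M\<close>; the measure carried by \<open>M\<close> itself is irrelevant. Finiteness is automatic, since
  all values are complex numbers.
\<close>

definition complex_measure :: "'a measure \<Rightarrow> ('a set \<Rightarrow> complex) \<Rightarrow> bool" where
  "complex_measure M \<mu> \<longleftrightarrow>
     (\<forall>A :: nat \<Rightarrow> 'a set. range A \<subseteq> sets M \<longrightarrow> disjoint_family A \<longrightarrow>
        (\<lambda>i. \<mu> (A i)) sums \<mu> (\<Union>i. A i))"

definition of_measure :: "'a measure \<Rightarrow> 'a set \<Rightarrow> complex" where
  "of_measure N = (\<lambda>A. complex_of_real (measure N A))"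

text \<open>
  The positive variation \<open>\<sigma>\<^sup>+(A) = sup {\<sigma>(B) | B \<subseteq> A measurable}\<close> of a real signed measure;
  \<open>B = {}\<close> is admitted, so the truncation of negative values by \<open>ennreal\<close> is harmless.
  The negative variation of \<open>\<sigma>\<close> is the positive variation of \<open>-\<sigma>\<close>.
\<close>

definition pos_variation :: "'a measure \<Rightarrow> ('a set \<Rightarrow> real) \<Rightarrow> 'a measure" where
  "pos_variation M \<sigma> = measure_of (space M) (sets M)
     (\<lambda>A. SUP B\<in>{B \<in> sets M. B \<subseteq> A}. ennreal (\<sigma> B))"

text \<open>
  Integration against a complex measure by means of the Jordan decompositions of its real and
  imaginary parts. Integrability is equivalent to integrability against the total variation.
\<close>

definition cintegrable :: "'a measure \<Rightarrow> ('a set \<Rightarrow> complex) \<Rightarrow> ('a \<Rightarrow> complex) \<Rightarrow> bool" where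
  "cintegrable M \<mu> f \<longleftrightarrow>
     integrable (pos_variation M (\<lambda>A. Re (\<mu> A))) f \<and>
     integrable (pos_variation M (\<lambda>A. - Re (\<mu> A))) f \<and>
     integrable (pos_variation M (\<lambda>A. Im (\<mu> A))) f \<and>
     integrable (pos_variation M (\<lambda>A. - Im (\<mu> A))) f"

definition cintegral :: "'a measure \<Rightarrow> ('a set \<Rightarrow> complex) \<Rightarrow> ('a \<Rightarrow> complex) \<Rightarrow> complex" where
  "cintegral M \<mu> f =
     integral\<^sup>L (pos_variation M (\<lambda>A. Re (\<mu> A))) f
     - integral\<^sup>L (pos_variation M (\<lambda>A. - Re (\<mu> A))) f
     + \<i> * (integral\<^sup>L (pos_variation M (\<lambda>A. Im (\<mu> A))) f
            - integral\<^sup>L (pos_variation M (\<lambda>A. - Im (\<mu> A))) f)"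

text \<open>
  Product of a complex measure with a finite positive measure,
  \<open>(\<mu> \<times> N)(E) = \<integral> N(E\<^sub>x) d\<mu>(x)\<close> with \<open>E\<^sub>x\<close> the section of \<open>E\<close> at \<open>x\<close>.
\<close>

definition cprod_measure ::
  "'a measure \<Rightarrow> ('a set \<Rightarrow> complex) \<Rightarrow> 'b measure \<Rightarrow> ('a \<times> 'b) set \<Rightarrow> complex" where
  "cprod_measure M \<mu> N E = cintegral M \<mu> (\<lambda>x. complex_of_real (measure N (Pair x -` E)))"

definition cdistr :: "'a measure \<Rightarrow> ('a set \<Rightarrow> complex) \<Rightarrow> ('a \<Rightarrow> 'b) \<Rightarrow> 'b set \<Rightarrow> complex" where
  "cdistr M \<mu> g Z = \<mu> (g -` Z \<inter> space M)"


section \<open>The measures \<open>\<eta>\<close> on \<open>[0,1)\<close> and \<open>\<nu>\<^sub>\<eta>\<close> on the disk\<close>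

abbreviation unit_disk :: "complex set" ("\<D>") where
  "\<D> \<equiv> ball 0 1"

abbreviation unit_circle :: "complex set" ("\<T>") where
  "\<T> \<equiv> sphere 0 1"

abbreviation borel_I :: "real measure" where
  "borel_I \<equiv> restrict_space borel {0..<1}"

abbreviation borel_disk :: "complex measure" where
  "borel_disk \<equiv> restrict_space borel \<D>"

text \<open>The Haar measure of total mass \<open>2\<pi>\<close> on the circle, realized as arc length.\<close>

definition haar_circle :: "complex measure" where
  "haar_circle = distr (restrict_space lborel {0..<2*pi}) (restrict_space borel \<T>) cis"

definition varkappa :: "(real set \<Rightarrow> complex) \<Rightarrow> real \<Rightarrow> complex" where
  "varkappa \<eta> r = 2 * \<eta> {r..<1} / complex_of_real (1 - r\<^sup>2)"

definition gamma_seq :: "(real set \<Rightarrow> complex) \<Rightarrow> nat \<Rightarrow> complex" where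
  "gamma_seq \<eta> k =
     2 * (of_nat k + 1) * cintegral borel_I \<eta> (\<lambda>r. complex_of_real (r ^ (2 * k)))"

definition beta_fun :: "(real set \<Rightarrow> complex) \<Rightarrow> real \<Rightarrow> complex" where
  "beta_fun \<eta> a = complex_of_real (2 * (1 - a\<^sup>2)\<^sup>2) *
     cintegral borel_I \<eta>
       (\<lambda>r. complex_of_real ((1 + a\<^sup>2 * r\<^sup>2) / (1 - a\<^sup>2 * r\<^sup>2) ^ 3))"

definition nu_measure :: "(real set \<Rightarrow> complex) \<Rightarrow> complex set \<Rightarrow> complex" where
  "nu_measure \<eta> = cdistr (borel_I \<Otimes>\<^sub>M haar_circle)
     (cprod_measure borel_I \<eta> haar_circle) (\<lambda>(r, \<tau>). complex_of_real r * \<tau>)"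

definition M_pos :: "real measure set" where
  "M_pos = {N. finite_measure N \<and> sets N = sets borel_I \<and>
     bounded (varkappa (of_measure N) ` {0..<1})}"

definition M_complex :: "(real set \<Rightarrow> complex) set" where
  "M_complex = {\<eta>. complex_measure borel_I \<eta> \<and>
     (\<exists>N1\<in>M_pos. \<exists>N2\<in>M_pos. \<exists>N3\<in>M_pos. \<exists>N4\<in>M_pos. \<forall>A\<in>sets borel_I.
        \<eta> A = of_measure N1 A - of_measure N2 A + \<i> * (of_measure N3 A - of_measure N4 A))}"

definition radial_measure :: "(complex set \<Rightarrow> complex) \<Rightarrow> bool" where
  "radial_measure \<mu> \<longleftrightarrow> complex_measure borel_disk \<mu> \<and>
     (\<forall>\<tau>\<in>\<T>. \<forall>Z\<in>sets borel_disk. \<mu> ((\<lambda>z. \<tau> * z) ` Z) = \<mu> Z)"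


section \<open>The Bergman space and its operators\<close>

text \<open>
  Elements are functions on the whole plane that vanish off the disk, so that equality in the
  Bergman space is equality of HOL functions.
\<close>

definition bergman :: "(complex \<Rightarrow> complex) set" where
  "bergman = {f. f holomorphic_on \<D> \<and> set_integrable lborel \<D> (\<lambda>z. (norm (f z))\<^sup>2) \<and>
     (\<forall>z. z \<notin> \<D> \<longrightarrow> f z = 0)}"

definition bergman_inner :: "(complex \<Rightarrow> complex) \<Rightarrow> (complex \<Rightarrow> complex) \<Rightarrow> complex" where
  "bergman_inner f g = (LINT z:\<D>|lborel. f z * cnj (g z))"

definition bergman_norm :: "(complex \<Rightarrow> complex) \<Rightarrow> real" where
  "bergman_norm f = sqrt (LINT z:\<D>|lborel. (norm (f z))\<^sup>2)"

definition bergman_basis :: "nat \<Rightarrow> complex \<Rightarrow> complex" where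
  "bergman_basis k z =
     (if z \<in> \<D> then complex_of_real (sqrt ((real k + 1) / pi)) * z ^ k else 0)"

definition bounded_operator :: "((complex \<Rightarrow> complex) \<Rightarrow> complex \<Rightarrow> complex) \<Rightarrow> bool" where
  "bounded_operator S \<longleftrightarrow>
     (\<forall>f\<in>bergman. S f \<in> bergman) \<and>
     (\<forall>f\<in>bergman. \<forall>g\<in>bergman. S (\<lambda>z. f z + g z) = (\<lambda>z. S f z + S g z)) \<and>
     (\<forall>c. \<forall>f\<in>bergman. S (\<lambda>z. c * f z) = (\<lambda>z. c * S f z)) \<and>
     (\<exists>C. \<forall>f\<in>bergman. bergman_norm (S f) \<le> C * bergman_norm f)"

definition rotation :: "complex \<Rightarrow> (complex \<Rightarrow> complex) \<Rightarrow> complex \<Rightarrow> complex" where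
  "rotation \<tau> f z = f (inverse \<tau> * z)"

definition bounded_radial_operator :: "((complex \<Rightarrow> complex) \<Rightarrow> complex \<Rightarrow> complex) \<Rightarrow> bool" where
  "bounded_radial_operator S \<longleftrightarrow> bounded_operator S \<and>
     (\<forall>\<tau>\<in>\<T>. \<forall>f\<in>bergman. S (rotation \<tau> f) = rotation \<tau> (S f))"

definition toeplitz :: "(complex set \<Rightarrow> complex) \<Rightarrow> (complex \<Rightarrow> complex) \<Rightarrow> complex \<Rightarrow> complex" where
  "toeplitz \<mu> f z =
     (if z \<in> \<D>
      then 1 / complex_of_real pi * cintegral borel_disk \<mu> (\<lambda>w. f w / (1 - z * cnj w)\<^sup>2)
      else 0)"

text \<open>
  The HOL integral is total (it is \<open>0\<close> for non-integrable functions), so convergence of the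
  integrals defining the Toeplitz operator has to be expressed separately.
\<close>

definition toeplitz_defined :: "(complex set \<Rightarrow> complex) \<Rightarrow> bool" where
  "toeplitz_defined \<mu> \<longleftrightarrow>
     (\<forall>f\<in>bergman. \<forall>z\<in>\<D>. cintegrable borel_disk \<mu> (\<lambda>w. f w / (1 - z * cnj w)\<^sup>2))"


section \<open>The isomorphism with \<open>\<ell>\<^sub>2\<close>\<close>

definition ell2 :: "(nat \<Rightarrow> complex) set" where
  "ell2 = {c. summable (\<lambda>k. (norm (c k))\<^sup>2)}"

definition ell2_inner :: "(nat \<Rightarrow> complex) \<Rightarrow> (nat \<Rightarrow> complex) \<Rightarrow> complex" where
  "ell2_inner c d = (\<Sum>k. c k * cnj (d k))"

definition bergman_R :: "(complex \<Rightarrow> complex) \<Rightarrow> nat \<Rightarrow> complex" where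
  "bergman_R f k = bergman_inner f (bergman_basis k)"

text \<open>The Hilbert space adjoint of \<^const>\<open>bergman_R\<close>.\<close>

definition bergman_R_adj :: "(nat \<Rightarrow> complex) \<Rightarrow> complex \<Rightarrow> complex" where
  "bergman_R_adj c = (THE g. g \<in> bergman \<and>
     (\<forall>f\<in>bergman. bergman_inner f g = ell2_inner (bergman_R f) c))"

definition mult_op :: "(nat \<Rightarrow> complex) \<Rightarrow> (nat \<Rightarrow> complex) \<Rightarrow> nat \<Rightarrow> complex" where
  "mult_op \<alpha> c k = \<alpha> k * c k"

definition dlog :: "nat \<Rightarrow> nat \<Rightarrow> real" where
  "dlog m n = \<bar>ln (real m + 1) - ln (real n + 1)\<bar>"

definition lipschitz_dlog :: "(nat \<Rightarrow> complex) \<Rightarrow> bool" where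
  "lipschitz_dlog \<alpha> \<longleftrightarrow> (\<exists>L\<ge>0. \<forall>m n. dist (\<alpha> m) (\<alpha> n) \<le> L * dlog m n)"

end

theory Submission
  imports Defs
begin

text \<open>
  A rotation invariant finite measure \<open>V\<close> on the disk makes the monomials orthogonal, so a power
  series \<open>f = \<Sum> a\<^sub>k z\<^sup>k\<close> satisfies \<open>\<integral> \<bar>f\<bar>\<^sup>2 dV = \<Sum> \<bar>a\<^sub>k\<bar>\<^sup>2 m\<^sub>k\<close> with \<open>m\<^sub>k = \<integral> \<bar>z\<bar>\<^sup>2\<^sup>k dV\<close>. For the area
  measure \<open>m\<^sub>k = \<pi>/(k+1)\<close>, which identifies the Bergman space with a weighted sequence space; for
  \<open>\<nu>\<^sub>\<eta>\<close> with \<open>\<eta>\<close> positive \<open>m\<^sub>k = \<pi> \<gamma>\<^sub>\<eta>(k)/(k+1)\<close>. Pairing \<open>f\<close> with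
  \<open>w \<mapsto> \<Sum> (k+1) (cnj z)\<^sup>k w\<^sup>k\<close>, the conjugate of the kernel, then shows that the Toeplitz operator multiplies \<open>a\<^sub>k\<close> by \<open>\<gamma>\<^sub>\<eta>(k)\<close>. All the bounds come
  from the tail estimate \<open>\<eta>([r,1)) \<le> K (1 - r\<^sup>2)\<close>, which by a layer cake argument yields
  \<open>\<integral> r\<^sup>2\<^sup>k d\<eta> \<le> K/(k+1)\<close>; inserting this into \<open>(1+x)/(1-x)\<^sup>3 = \<Sum> (k+1)\<^sup>2 x\<^sup>k\<close> bounds \<open>\<beta>\<^sub>\<eta>\<close>.
\<close>

section \<open>Integration against complex measures\<close>

text \<open>\<open>cintegral\<close> is defined through Jordan variations, while
  \<open>M_complex\<close> supplies some decomposition whose parts have controlled tails. Integrals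
  must therefore be computed along the given parts. With P and Q the positive and negative
  variations of \<open>N1 - N2\<close>, the positive measures satisfy N1 + Q = N2 + P, an identity
  that can be integrated before anything is subtracted. Afterwards one positive measure is treated
  at a time, and the weights i^j recombine them; this is the origin of the factor 4 in the final
  constants.

  Orthogonality comes from rotation invariance alone, so area and \<open>nu_pos\<close> share one
  locale. A power series may be unbounded near the circle, so Parseval is proved on closed balls of
  radius below 1 and carried to the disk by monotone convergence in \<open>ennreal\<close>. In that
  form it works in both directions: for area it turns square integrability into a condition on
  Taylor coefficients, and under the moment bound it turns that condition into integrability.
  Polarization then gives convergence and value of the Toeplitz integral, and the operator
  statements become facts about a diagonal action on coefficients.\<close>

text \<open>The identity is stable under sums, scaling and increasing limits, so it passes from
  indicators to all nonnegative functions. Writing it with sums on both sides avoids subtraction in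
  \<open>ennreal\<close>.\<close>

lemma nn_integral_add_measures_cong:
  assumes sets: "sets P = sets M" "sets Q = sets M" "sets N1 = sets M" "sets N2 = sets M"
    and eq: "\<And>A. A \<in> sets M \<Longrightarrow> emeasure N1 A + emeasure Q A = emeasure N2 A + emeasure P A"
    and f: "f \<in> borel_measurable M"
  shows "nn_integral N1 f + nn_integral Q f = nn_integral N2 f + nn_integral P f"
  using f
proof (induction rule: borel_measurable_induct)
  case (cong f g)
  have "nn_integral X f = nn_integral X g" if "sets X = sets M" for X
    using cong(3) sets_eq_imp_space_eq[OF that] by (intro nn_integral_cong) auto
  then show ?case using cong(4) sets by simp
next
  case (set A)
  then show ?case using eq[OF set] sets by simp
next
  case (mult u c)
  have "nn_integral X (\<lambda>x. c * u x) = c * nn_integral X u" if "sets X = sets M" for X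
    using mult(2) measurable_cong_sets[OF that refl] by (intro nn_integral_cmult) auto
  then show ?case using mult(4) sets by (simp flip: distrib_left)
next
  case (add u v)
  have "nn_integral X (\<lambda>x. v x + u x) = nn_integral X v + nn_integral X u" if "sets X = sets M" for X
    using add(1,3) measurable_cong_sets[OF that refl] by (intro nn_integral_add) auto
  then show ?case using add(6,7) sets by simp (metis (no_types, lifting) add.assoc add.left_commute)
next
  case (seq U)
  have conv: "nn_integral X (Sup (range U)) = (SUP i. nn_integral X (U i))" if "sets X = sets M" for X
    unfolding SUP_apply[abs_def]
    using seq(1,3) measurable_cong_sets[OF that refl]
    by (intro nn_integral_monotone_convergence_SUP) auto
  have inc: "incseq (\<lambda>i. nn_integral X (U i))" for X
    using seq(3) by (auto simp: incseq_def le_fun_def intro!: nn_integral_mono)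
  show ?case
    unfolding sets[THEN conv] by (subst (1 2) ennreal_SUP_add[symmetric]) (auto intro: inc simp: seq(5))
qed

lemma nn_integral_mono_emeasure:
  assumes sets: "sets P = sets M" and le: "\<And>A. A \<in> sets M \<Longrightarrow> emeasure P A \<le> emeasure M A"
    and f: "f \<in> borel_measurable M"
  shows "nn_integral P f \<le> nn_integral M f"
  using f
proof (induction rule: borel_measurable_induct)
  case (cong f g)
  have "nn_integral X f = nn_integral X g" if "sets X = sets M" for X
    using cong(3) sets_eq_imp_space_eq[OF that] by (intro nn_integral_cong) auto
  then show ?case using cong(4) sets by simp
next
  case (set A)
  then show ?case using le[OF set] sets by simp
next
  case (mult u c)
  have "nn_integral X (\<lambda>x. c * u x) = c * nn_integral X u" if "sets X = sets M" for X
    using mult(2) measurable_cong_sets[OF that refl] by (intro nn_integral_cmult) auto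
  then show ?case using mult(4) sets by (simp add: mult_left_mono)
next
  case (add u v)
  have "nn_integral X (\<lambda>x. v x + u x) = nn_integral X v + nn_integral X u" if "sets X = sets M" for X
    using add(1,3) measurable_cong_sets[OF that refl] by (intro nn_integral_add) auto
  then show ?case using add(6,7) sets by (simp add: add_mono)
next
  case (seq U)
  have conv: "nn_integral X (Sup (range U)) = (SUP i. nn_integral X (U i))" if "sets X = sets M" for X
    unfolding SUP_apply[abs_def]
    using seq(1,3) measurable_cong_sets[OF that refl]
    by (intro nn_integral_monotone_convergence_SUP) auto
  show ?case
    unfolding conv[OF refl] conv[OF sets] by (rule SUP_mono) (use seq(5) in blast)
qed

text \<open>This transfers integrability from the parts of a given decomposition to the variations,
  which they dominate.\<close>

lemma integrable_mono_emeasure: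
  fixes f :: "'a \<Rightarrow> 'b::{banach, second_countable_topology}"
  assumes sets: "sets P = sets M" and le: "\<And>A. A \<in> sets M \<Longrightarrow> emeasure P A \<le> emeasure M A"
    and f: "integrable M f"
  shows "integrable P f"
proof (rule integrableI_bounded)
  show "f \<in> borel_measurable P"
    using borel_measurable_integrable[OF f] measurable_cong_sets[OF sets refl] by blast
  have "(\<integral>\<^sup>+x. ennreal (norm (f x)) \<partial>P) \<le> (\<integral>\<^sup>+x. ennreal (norm (f x)) \<partial>M)"
    using sets le f by (intro nn_integral_mono_emeasure) auto
  also have "\<dots> < \<infinity>" using f by (simp add: integrable_iff_bounded)
  finally show "(\<integral>\<^sup>+x. ennreal (norm (f x)) \<partial>P) < \<infinity>" .
qed

text \<open>Real and imaginary parts, and then positive and negative parts, reduce this to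
  nonnegative functions, where integrability turns the \<open>ennreal\<close> identity into one
  between real numbers.\<close>

lemma integral_add_measures_cong:
  fixes f :: "'a \<Rightarrow> complex"
  assumes sets: "sets P = sets M" "sets Q = sets M" "sets N1 = sets M" "sets N2 = sets M"
    and eq: "\<And>A. A \<in> sets M \<Longrightarrow> emeasure N1 A + emeasure Q A = emeasure N2 A + emeasure P A"
    and int: "integrable P f" "integrable Q f" "integrable N1 f" "integrable N2 f"
  shows "integral\<^sup>L N1 f + integral\<^sup>L Q f = integral\<^sup>L N2 f + integral\<^sup>L P f"
proof -
  have real: "integral\<^sup>L N1 g + integral\<^sup>L Q g = integral\<^sup>L N2 g + integral\<^sup>L P g"
    if g: "integrable P g" "integrable Q g" "integrable N1 g" "integrable N2 g" for g :: "'a \<Rightarrow> real"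
  proof -
    have nonneg: "integral\<^sup>L N1 h + integral\<^sup>L Q h = integral\<^sup>L N2 h + integral\<^sup>L P h"
      if h: "integrable P h" "integrable Q h" "integrable N1 h" "integrable N2 h" "\<And>x. h x \<ge> 0"
      for h :: "'a \<Rightarrow> real"
    proof -
      have "(\<integral>\<^sup>+x. ennreal (h x) \<partial>N1) + (\<integral>\<^sup>+x. ennreal (h x) \<partial>Q)
          = (\<integral>\<^sup>+x. ennreal (h x) \<partial>N2) + (\<integral>\<^sup>+x. ennreal (h x) \<partial>P)"
        using borel_measurable_integrable[OF h(1)] measurable_cong_sets[OF sets(1) refl]
        by (intro nn_integral_add_measures_cong[OF sets eq] measurable_compose[OF _ measurable_ennreal]) auto
      then have "ennreal (integral\<^sup>L N1 h + integral\<^sup>L Q h) = ennreal (integral\<^sup>L N2 h + integral\<^sup>L P h)"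
        using h by (simp add: nn_integral_eq_integral)
      moreover have "integral\<^sup>L X h \<ge> 0" for X
        using h(5) by (intro integral_nonneg_AE) auto
      ultimately show ?thesis by (subst (asm) ennreal_inj) auto
    qed
    have split: "integral\<^sup>L X g = integral\<^sup>L X (\<lambda>x. max 0 (g x)) - integral\<^sup>L X (\<lambda>x. max 0 (- g x))"
      if "integrable X g" for X
    proof -
      have "integral\<^sup>L X g = (\<integral>x. max 0 (g x) - max 0 (- g x) \<partial>X)"
        by (intro Bochner_Integration.integral_cong) (auto simp: max_def)
      then show ?thesis using that by simp
    qed
    show ?thesis
      using nonneg[of "\<lambda>x. max 0 (g x)"] nonneg[of "\<lambda>x. max 0 (- g x)"] split g by simp
  qed
  show ?thesis
    using real[of "\<lambda>x. Re (f x)"] real[of "\<lambda>x. Im (f x)"] int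
    by (simp add: complex_eq_iff)
qed

text \<open>\<open>Y\<close> is a Hahn set for \<open>N1 - N2\<close>. Replacing B by B \<inter> Y
  discards a part on which \<sigma> is nonpositive, and enlarging B \<inter> Y to A \<inter> Y adds
  one on which it is nonnegative. Hence the supremum defining the variation is attained at A
  \<inter> Y.\<close>

lemma
  assumes fin: "finite_measure N1" "finite_measure N2" and sets: "sets N1 = sets M" "sets N2 = sets M"
    and \<sigma>: "\<And>A. A \<in> sets M \<Longrightarrow> \<sigma> A = measure N1 A - measure N2 A"
    and Y: "Y \<in> sets M" "\<And>X. X \<in> sets M \<Longrightarrow> X \<subseteq> Y \<Longrightarrow> measure N2 X \<le> measure N1 X"
      "\<And>X. X \<in> sets M \<Longrightarrow> X \<inter> Y = {} \<Longrightarrow> measure N1 X \<le> measure N2 X"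
  shows sets_pos_variation_Hahn: "sets (pos_variation M \<sigma>) = sets M"
    and emeasure_pos_variation_Hahn:
      "\<And>A. A \<in> sets M \<Longrightarrow> emeasure (pos_variation M \<sigma>) A = ennreal (\<sigma> (A \<inter> Y))"
proof -
  interpret N1: finite_measure N1 by fact
  interpret N2: finite_measure N2 by fact
  show "sets (pos_variation M \<sigma>) = sets M"
    unfolding pos_variation_def by simp
  define m where "m A = (SUP B\<in>{B \<in> sets M. B \<subseteq> A}. ennreal (\<sigma> B))" for A
  have nonneg: "\<sigma> (A \<inter> Y) \<ge> 0" if "A \<in> sets M" for A
    using \<sigma>[of "A \<inter> Y"] Y(1) Y(2)[of "A \<inter> Y"] that by auto
  have m: "m A = ennreal (\<sigma> (A \<inter> Y))" if A: "A \<in> sets M" for A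
    unfolding m_def
  proof (rule antisym)
    show "(SUP B\<in>{B \<in> sets M. B \<subseteq> A}. ennreal (\<sigma> B)) \<le> ennreal (\<sigma> (A \<inter> Y))"
    proof (rule SUP_least)
      fix B assume B: "B \<in> {B \<in> sets M. B \<subseteq> A}"
      have split: "measure N X = measure N (X \<inter> Y) + measure N (X - Y)"
        if "finite_measure N" "sets N = sets M" "X \<in> sets M" for N X
      proof -
        interpret finite_measure N by fact
        have "measure N ((X \<inter> Y) \<union> (X - Y)) = measure N (X \<inter> Y) + measure N (X - Y)"
          using that Y(1) by (intro finite_measure_Union) auto
        then show ?thesis by (simp add: Int_Diff_Un)
      qed
      have "\<sigma> B \<le> \<sigma> (B \<inter> Y)"
        using \<sigma>[of B] \<sigma>[of "B \<inter> Y"] split[of N1 B] split[of N2 B] Y(3)[of "B - Y", OF _ Diff_disjoint[THEN trans[OF Int_commute]]] B Y(1) fin sets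
        by auto
      also have "\<sigma> (B \<inter> Y) \<le> \<sigma> (A \<inter> Y)"
      proof -
        have d: "measure N (A \<inter> Y) = measure N (B \<inter> Y) + measure N ((A - B) \<inter> Y)"
          if "finite_measure N" "sets N = sets M" for N
        proof -
          interpret finite_measure N by fact
          have "measure N ((B \<inter> Y) \<union> ((A - B) \<inter> Y)) = measure N (B \<inter> Y) + measure N ((A - B) \<inter> Y)"
            using that Y(1) A B by (intro finite_measure_Union) auto
          moreover have "(B \<inter> Y) \<union> ((A - B) \<inter> Y) = A \<inter> Y" using B by auto
          ultimately show ?thesis by simp
        qed
        show ?thesis
          using \<sigma>[of "B \<inter> Y"] \<sigma>[of "A \<inter> Y"] d[of N1] d[of N2] Y(2)[of "(A - B) \<inter> Y"] A B Y(1) fin sets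
          by auto
      qed
      finally show "ennreal (\<sigma> B) \<le> ennreal (\<sigma> (A \<inter> Y))" by (rule ennreal_leI)
    qed
    show "ennreal (\<sigma> (A \<inter> Y)) \<le> (SUP B\<in>{B \<in> sets M. B \<subseteq> A}. ennreal (\<sigma> B))"
      using A Y(1) by (intro SUP_upper) auto
  qed
  \<comment> \<open>\<open>measure_of\<close> falls back to the zero measure unless its set function
    is positive and countably additive. Additivity is inherited from \<sigma> through the formula
    \<open>m\<close>.\<close>
  have "emeasure (pos_variation M \<sigma>) A = m A" if A: "A \<in> sets M" for A
  proof (rule emeasure_measure_of)
    show "pos_variation M \<sigma> = measure_of (space M) (sets M) m"
      unfolding pos_variation_def m_def ..
    show "sets M \<subseteq> Pow (space M)" by (rule sets.space_closed)
    show "A \<in> sets (pos_variation M \<sigma>)" using A by (simp add: pos_variation_def)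
    have e: "\<sigma> {} = 0" using \<sigma>[of "{}"] by simp
    show "positive (sets (pos_variation M \<sigma>)) m"
      by (auto simp: positive_def m e)
    show "countably_additive (sets (pos_variation M \<sigma>)) m"
    proof (rule countably_additiveI)
      fix F :: "nat \<Rightarrow> 'a set"
      assume F: "range F \<subseteq> sets (pos_variation M \<sigma>)" "disjoint_family F"
      then have F': "\<And>i. F i \<in> sets M" by (auto simp: pos_variation_def)
      have U: "\<Union> (range F) \<in> sets M" using F' by auto
      have s: "(\<lambda>i. measure N (F i \<inter> Y)) sums measure N ((\<Union>i. F i) \<inter> Y)"
        if "finite_measure N" "sets N = sets M" for N
      proof -
        interpret finite_measure N by fact
        have "(\<lambda>i. measure N (F i \<inter> Y)) sums measure N (\<Union>i. F i \<inter> Y)"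
          using F' F(2) Y(1) that by (intro finite_measure_UNION) (auto simp: disjoint_family_on_def)
        then show ?thesis by simp
      qed
      have "(\<lambda>i. \<sigma> (F i \<inter> Y)) sums \<sigma> ((\<Union>i. F i) \<inter> Y)"
        using sums_diff[OF s[OF fin(1) sets(1)] s[OF fin(2) sets(2)]]
          \<sigma>[OF sets.Int[OF F' Y(1)]] \<sigma>[OF sets.Int[OF U Y(1)]]
        by presburger
      from suminf_ennreal2[OF nonneg[OF F'] sums_summable[OF this]] sums_unique[OF this]
      have "(\<Sum>i. ennreal (\<sigma> (F i \<inter> Y))) = ennreal (\<sigma> ((\<Union>i. F i) \<inter> Y))"
        by simp
      then show "(\<Sum>i. m (F i)) = m (\<Union> (range F))" using m F' U by simp
    qed
  qed
  then show "\<And>A. A \<in> sets M \<Longrightarrow> emeasure (pos_variation M \<sigma>) A = ennreal (\<sigma> (A \<inter> Y))"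
    using m by simp
qed

text \<open>The Jordan decomposition is minimal: the positive variation lies below \<open>N1\<close>
  and the negative one below \<open>N2\<close>, which gives integrability. Any decomposition into
  finite measures therefore yields the same difference of integrals.\<close>

lemma
  fixes f :: "'a \<Rightarrow> complex"
  assumes fin: "finite_measure N1" "finite_measure N2" and sets: "sets N1 = sets M" "sets N2 = sets M"
    and \<sigma>: "\<And>A. A \<in> sets M \<Longrightarrow> \<sigma> A = measure N1 A - measure N2 A"
    and f: "integrable N1 f" "integrable N2 f"
  shows integrable_pos_variation: "integrable (pos_variation M \<sigma>) f"
    and integrable_neg_variation: "integrable (pos_variation M (\<lambda>A. - \<sigma> A)) f"
    and integral_variation_diff: "integral\<^sup>L (pos_variation M \<sigma>) f
      - integral\<^sup>L (pos_variation M (\<lambda>A. - \<sigma> A)) f = integral\<^sup>L N1 f - integral\<^sup>L N2 f"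
proof -
  interpret N1: finite_measure N1 by fact
  interpret N2: finite_measure N2 by fact
  define P where "P = pos_variation M \<sigma>"
  define Q where "Q = pos_variation M (\<lambda>A. - \<sigma> A)"
  have "sets N2 = sets N1" using sets by simp
  from finite_unsigned_Hahn_decomposition[OF fin this]
  obtain Y where Y: "Y \<in> sets N1" "\<forall>X\<in>sets N1. X \<subseteq> Y \<longrightarrow> emeasure N2 X \<le> emeasure N1 X"
    "\<forall>X\<in>sets N1. X \<inter> Y = {} \<longrightarrow> emeasure N1 X \<le> emeasure N2 X"
    by (elim bexE conjE)
  have Y1: "Y \<in> sets M" "\<And>X. X \<in> sets M \<Longrightarrow> X \<subseteq> Y \<Longrightarrow> measure N2 X \<le> measure N1 X"
    "\<And>X. X \<in> sets M \<Longrightarrow> X \<inter> Y = {} \<Longrightarrow> measure N1 X \<le> measure N2 X"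
    using Y unfolding sets by (auto simp: N1.emeasure_eq_measure N2.emeasure_eq_measure)
  \<comment> \<open>The complement is a Hahn set for -\<sigma> with the roles of \<open>N1\<close>
    and \<open>N2\<close> exchanged, so the previous lemma also describes the negative
    variation.\<close>
  define Y' where "Y' = space M - Y"
  have Y2: "Y' \<in> sets M" "\<And>X. X \<in> sets M \<Longrightarrow> X \<subseteq> Y' \<Longrightarrow> measure N1 X \<le> measure N2 X"
    "\<And>X. X \<in> sets M \<Longrightarrow> X \<inter> Y' = {} \<Longrightarrow> measure N2 X \<le> measure N1 X"
  proof -
    show "Y' \<in> sets M" using Y1(1) unfolding Y'_def by auto
    show "measure N1 X \<le> measure N2 X" if "X \<in> sets M" "X \<subseteq> Y'" for X
      using Y1(3)[OF that(1)] that(2) unfolding Y'_def by blast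
    show "measure N2 X \<le> measure N1 X" if "X \<in> sets M" "X \<inter> Y' = {}" for X
      using Y1(2)[OF that(1)] that(2) sets.sets_into_space[OF that(1)] unfolding Y'_def by blast
  qed
  have \<sigma>': "\<And>A. A \<in> sets M \<Longrightarrow> - \<sigma> A = measure N2 A - measure N1 A"
    using \<sigma> by simp
  have P: "sets P = sets M"
    unfolding P_def by (rule sets_pos_variation_Hahn[OF fin sets \<sigma> Y1])
  have P_Y: "emeasure P A = ennreal (\<sigma> (A \<inter> Y))" if "A \<in> sets M" for A
    unfolding P_def using that by (rule emeasure_pos_variation_Hahn[OF fin sets \<sigma> Y1, rotated -1])
  have Q: "sets Q = sets M"
    unfolding Q_def by (rule sets_pos_variation_Hahn[OF fin(2,1) sets(2,1) \<sigma>' Y2])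
  have Q_Y: "emeasure Q A = ennreal (- \<sigma> (A \<inter> Y'))" if "A \<in> sets M" for A
    unfolding Q_def using that by (rule emeasure_pos_variation_Hahn[OF fin(2,1) sets(2,1) \<sigma>' Y2, rotated -1])
  have P_le: "emeasure P A \<le> emeasure N1 A" if A: "A \<in> sets N1" for A
  proof -
    have "\<sigma> (A \<inter> Y) \<le> measure N1 (A \<inter> Y)"
      using \<sigma>[of "A \<inter> Y"] A Y1(1) sets by auto
    also have "\<dots> \<le> measure N1 A" using A by (intro N1.finite_measure_mono) auto
    finally show ?thesis using P_Y[of A] A unfolding sets N1.emeasure_eq_measure by (simp only: ennreal_leI)
  qed
  have Q_le: "emeasure Q A \<le> emeasure N2 A" if A: "A \<in> sets N2" for A
  proof -
    have "- \<sigma> (A \<inter> Y') \<le> measure N2 (A \<inter> Y')"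
      using \<sigma>[of "A \<inter> Y'"] A Y2(1) sets by auto
    also have "\<dots> \<le> measure N2 A" using A by (intro N2.finite_measure_mono) auto
    finally show ?thesis using Q_Y[of A] A unfolding sets N2.emeasure_eq_measure by (simp only: ennreal_leI)
  qed
  show iP: "integrable P f"
    by (rule integrable_mono_emeasure[OF trans[OF P sets(1)[symmetric]] P_le f(1)])
  show iQ: "integrable Q f"
    by (rule integrable_mono_emeasure[OF trans[OF Q sets(2)[symmetric]] Q_le f(2)])
  have eq: "emeasure N1 A + emeasure Q A = emeasure N2 A + emeasure P A" if A: "A \<in> sets M" for A
  proof -
    have split: "measure N A = measure N (A \<inter> Y) + measure N (A \<inter> Y')"
      if "finite_measure N" "sets N = sets M" for N
    proof -
      interpret finite_measure N by fact
      have "measure N ((A \<inter> Y) \<union> (A \<inter> Y')) = measure N (A \<inter> Y) + measure N (A \<inter> Y')"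
        using that Y1(1) Y2(1) A unfolding Y'_def by (intro finite_measure_Union) auto
      moreover have "(A \<inter> Y) \<union> (A \<inter> Y') = A"
        using sets.sets_into_space[OF A] unfolding Y'_def by auto
      ultimately show ?thesis by simp
    qed
    have "\<sigma> (A \<inter> Y) \<ge> 0" "- \<sigma> (A \<inter> Y') \<ge> 0"
      using \<sigma>[of "A \<inter> Y"] \<sigma>[of "A \<inter> Y'"] Y1(1) Y2(1) Y1(2)[of "A \<inter> Y"] Y2(2)[of "A \<inter> Y'"] A by auto
    \<comment> \<open>This is \<sigma>(A) = \<sigma>(A \<inter> Y) + \<sigma>(A \<inter> Y'),
      rearranged so that both sides become sums of nonnegative terms.\<close>
    moreover have "measure N1 A - \<sigma> (A \<inter> Y') = measure N2 A + \<sigma> (A \<inter> Y)"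
      using \<sigma>[of "A \<inter> Y"] \<sigma>[of "A \<inter> Y'"] split[of N1] split[of N2] fin sets A Y1(1) Y2(1)
      by auto
    ultimately have "ennreal (measure N1 A) + ennreal (- \<sigma> (A \<inter> Y')) = ennreal (measure N2 A) + ennreal (\<sigma> (A \<inter> Y))"
      by (subst (1 2) ennreal_plus[symmetric]) auto
    then show ?thesis unfolding P_Y[OF A] Q_Y[OF A] N1.emeasure_eq_measure N2.emeasure_eq_measure .
  qed
  have "integral\<^sup>L N1 f + integral\<^sup>L Q f = integral\<^sup>L N2 f + integral\<^sup>L P f"
    by (rule integral_add_measures_cong[OF P Q sets eq iP iQ f])
  then show "integral\<^sup>L P f - integral\<^sup>L Q f = integral\<^sup>L N1 f - integral\<^sup>L N2 f"
    by (simp add: algebra_simps)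
qed

text \<open>
  The weights \<open>\<i>\<^sup>j\<close> order a decomposition \<open>\<eta>\<^sub>1 - \<eta>\<^sub>2 + \<i>(\<eta>\<^sub>3 - \<eta>\<^sub>4)\<close> as \<open>\<eta>\<^sub>1, \<eta>\<^sub>3, \<eta>\<^sub>2, \<eta>\<^sub>4\<close>.
\<close>

definition four_part :: "'a measure \<Rightarrow> ('a set \<Rightarrow> complex) \<Rightarrow> (nat \<Rightarrow> 'a measure) \<Rightarrow> bool" where
  "four_part M \<mu> N \<longleftrightarrow> (\<forall>j<4. finite_measure (N j) \<and> sets (N j) = sets M) \<and>
     (\<forall>A\<in>sets M. \<mu> A = (\<Sum>j<4. \<i> ^ j * of_real (measure (N j) A)))"

lemma sum_lessThan_4: "(\<Sum>j<4. f j) = f 0 + f 1 + f 2 + f (3::nat)" for f :: "nat \<Rightarrow> 'a::comm_monoid_add"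
  by (simp add: eval_nat_numeral)

text \<open>Since i^j runs through 1, i, -1, -i, the real part of \<mu> is \<open>N 0\<close> minus
  \<open>N 2\<close> and the imaginary part is \<open>N 1\<close> minus \<open>N 3\<close>. The
  comparison with the variations applies to each of the two.\<close>

lemma
  assumes N: "four_part M \<mu> N" and f: "\<And>j. j < 4 \<Longrightarrow> integrable (N j) f"
  shows cintegrable_four_part: "cintegrable M \<mu> f"
    and cintegral_four_part: "cintegral M \<mu> f = (\<Sum>j<4. \<i> ^ j * integral\<^sup>L (N j) f)"
proof -
  have fin: "finite_measure (N j)" and sets: "sets (N j) = sets M" if "j < 4" for j
    using N that unfolding four_part_def by auto
  have \<mu>: "\<mu> A = (\<Sum>j<4. \<i> ^ j * of_real (measure (N j) A))" if "A \<in> sets M" for A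
    using N that unfolding four_part_def by auto
  have Re: "Re (\<mu> A) = measure (N 0) A - measure (N 2) A"
    and Im: "Im (\<mu> A) = measure (N 1) A - measure (N 3) A" if "A \<in> sets M" for A
    using \<mu>[OF that] by (auto simp: sum_lessThan_4 power3_eq_cube)
  note R = fin[of 0] fin[of 2] sets[of 0] sets[of 2] Re f[of 0] f[of 2]
  note I = fin[of 1] fin[of 3] sets[of 1] sets[of 3] Im f[of 1] f[of 3]
  show "cintegrable M \<mu> f"
    unfolding cintegrable_def
    using integrable_pos_variation[OF R] integrable_neg_variation[OF R]
      integrable_pos_variation[OF I] integrable_neg_variation[OF I]
    by simp
  show "cintegral M \<mu> f = (\<Sum>j<4. \<i> ^ j * integral\<^sup>L (N j) f)"
    unfolding cintegral_def integral_variation_diff[OF R, simplified] integral_variation_diff[OF I, simplified]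
    by (simp add: sum_lessThan_4 power3_eq_cube algebra_simps)
qed

lemma complex_measure_four_part:
  assumes "four_part M \<mu> N"
  shows "complex_measure M \<mu>"
  unfolding complex_measure_def
proof (intro allI impI)
  fix A :: "nat \<Rightarrow> 'a set" assume A: "range A \<subseteq> sets M" "disjoint_family A"
  have "(\<lambda>i. \<Sum>j<4. \<i> ^ j * of_real (measure (N j) (A i))) sums
      (\<Sum>j<4. \<i> ^ j * of_real (measure (N j) (\<Union>i. A i)))"
  proof (intro sums_sum sums_mult)
    fix j :: nat assume "j \<in> {..<4}"
    then interpret finite_measure "N j" using assms unfolding four_part_def by auto
    have "(\<lambda>i. measure (N j) (A i)) sums measure (N j) (\<Union>i. A i)"
      using assms A \<open>j \<in> _\<close> by (intro finite_measure_UNION) (auto simp: four_part_def)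
    then show "(\<lambda>i. complex_of_real (measure (N j) (A i))) sums of_real (measure (N j) (\<Union>i. A i))"
      by (rule sums_of_real)
  qed
  moreover have "\<mu> (A i) = (\<Sum>j<4. \<i> ^ j * of_real (measure (N j) (A i)))" for i
    using assms A unfolding four_part_def by blast
  moreover have "\<mu> (\<Union>i. A i) = (\<Sum>j<4. \<i> ^ j * of_real (measure (N j) (\<Union>i. A i)))"
    using assms A unfolding four_part_def by blast
  ultimately show "(\<lambda>i. \<mu> (A i)) sums \<mu> (\<Union>i. A i)" by simp
qed

section \<open>Rotation invariant measures on the disk\<close>

text \<open>The value 0 off the disk matches the convention in \<open>bergman\<close>, so that a
  Bergman function equals its power series as a HOL function.\<close>

definition power_series_on_disk :: "(nat \<Rightarrow> complex) \<Rightarrow> complex \<Rightarrow> complex" where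
  "power_series_on_disk a z = (if z \<in> \<D> then \<Sum>k. a k * z ^ k else 0)"

text \<open>The weight is the area moment without its factor \<pi>. These turn out to be exactly the
  Taylor coefficient sequences of Bergman functions.\<close>

definition bergman_coeffs :: "(nat \<Rightarrow> complex) set" where
  "bergman_coeffs = {a. summable (\<lambda>k. (norm (a k))\<^sup>2 / (real k + 1))}"

definition moment :: "complex measure \<Rightarrow> nat \<Rightarrow> real" where
  "moment V k = (\<integral>z. norm z ^ (2 * k) \<partial>V)"

lemma bergman_coeffs_summable:
  assumes a: "a \<in> bergman_coeffs" and z: "norm z < 1"
  shows "summable (\<lambda>k. norm (a k * z ^ k))"
proof -
  have s: "summable (\<lambda>k. (norm (a k))\<^sup>2 / (real k + 1))"
    using a unfolding bergman_coeffs_def by simp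
  show ?thesis
  proof (rule summable_comparison_test)
    have "summable (\<lambda>k. of_nat (Suc k) * norm z ^ k)"
      using geometric_deriv_sums[of "norm z"] z by (auto simp: sums_iff)
    then show "summable (\<lambda>k. (norm (a k))\<^sup>2 / (real k + 1) + real (Suc k) * norm z ^ k)"
      by (rule summable_add[OF s])
    show "\<exists>N. \<forall>n\<ge>N. norm (norm (a n * z ^ n)) \<le> (norm (a n))\<^sup>2 / (real n + 1) + real (Suc n) * norm z ^ n"
    proof (intro exI allI impI)
      fix n :: nat
      define q where "q = norm z ^ n"
      have q: "0 \<le> q" "q \<le> 1" using z by (auto simp: q_def power_le_one)
      \<comment> \<open>The factor sqrt(n+1) is moved from one factor to the other, so that 2xy
        \<le> x^2 + y^2 produces the weighted square of the coefficient plus a term of a convergent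
        series. As |z|^n \<le> 1, its square in y^2 may be replaced by |z|^n itself.\<close>
      define x where "x = norm (a n) / sqrt (real n + 1)"
      define y where "y = sqrt (real n + 1) * q"
      have "2 * x * y \<le> x\<^sup>2 + y\<^sup>2" by (rule sum_squares_bound)
      moreover have "x * y = norm (a n) * q" unfolding x_def y_def by simp
      moreover have "x\<^sup>2 = (norm (a n))\<^sup>2 / (real n + 1)" unfolding x_def by (simp add: power_divide)
      moreover have "y\<^sup>2 \<le> (real n + 1) * q"
        unfolding y_def power_mult_distrib using q by (simp add: power2_eq_square mult_left_le_one_le)
      moreover have "norm (a n) * q \<ge> 0" using q by simp
      ultimately show "norm (norm (a n * z ^ n)) \<le> (norm (a n))\<^sup>2 / (real n + 1) + real (Suc n) * norm z ^ n"
        unfolding q_def[symmetric] norm_mult norm_power by (simp add: add.commute)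
    qed
  qed
qed

lemma disk_radius_approx:
  obtains r :: "nat \<Rightarrow> real" where "incseq r" "\<And>i. 0 < r i" "\<And>i. r i < 1" "r \<longlonglongrightarrow> 1"
proof
  define r where "r n = 1 - 1 / (real n + 2)" for n
  show "incseq r" unfolding r_def incseq_def by (auto simp: field_simps)
  show "0 < r i" "r i < 1" for i unfolding r_def by (auto simp: field_simps)
  have "(\<lambda>n. 1 / (real n + 2)) \<longlonglongrightarrow> 0"
    by real_asymp
  then have "(\<lambda>n. 1 - 1 / (real n + 2)) \<longlonglongrightarrow> 1 - 0" by (intro tendsto_intros)
  then show "r \<longlonglongrightarrow> 1" by (simp add: r_def[abs_def])
qed

text \<open>The locale is instantiated with area measure on the disk and with each
  \<open>nu_pos N\<close>.\<close>

locale rotation_invariant = finite_measure V for V :: "complex measure" +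
  assumes sets_V: "sets V = sets borel_disk"
    and distr_rotate: "norm \<tau> = 1 \<Longrightarrow> distr V V (\<lambda>z. \<tau> * z) = V"
begin

lemma space_V: "space V = \<D>"
  using sets_eq_imp_space_eq[OF sets_V] by (simp add: space_restrict_space)

lemma borel_measurable_V:
  fixes f :: "complex \<Rightarrow> 'b::topological_space"
  assumes "f \<in> borel_measurable borel" shows "f \<in> borel_measurable V"
  using measurable_restrict_space1[OF assms, of \<D>] measurable_cong_sets[OF sets_V refl] by blast

lemma measurable_rotate: "norm \<tau> = 1 \<Longrightarrow> (\<lambda>z. \<tau> * z) \<in> measurable V V"
  unfolding measurable_cong_sets[OF sets_V sets_V]
  by (rule measurable_restrict_space3) (auto simp: norm_mult)

lemma integral_rotate:
  fixes f :: "complex \<Rightarrow> complex"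
  assumes \<tau>: "norm \<tau> = 1" and f: "f \<in> borel_measurable borel"
  shows "(\<integral>z. f (\<tau> * z) \<partial>V) = integral\<^sup>L V f"
proof -
  have "integral\<^sup>L V f = integral\<^sup>L (distr V V (\<lambda>z. \<tau> * z)) f"
    using distr_rotate[OF \<tau>] by simp
  also have "\<dots> = (\<integral>z. f (\<tau> * z) \<partial>V)"
    by (rule integral_distr[OF measurable_rotate[OF \<tau>] borel_measurable_V[OF f]])
  finally show ?thesis by simp
qed

lemma integrable_cball:
  fixes f :: "complex \<Rightarrow> complex"
  assumes f: "continuous_on UNIV f"
  shows "integrable V (\<lambda>z. indicat_real (cball 0 R) z *\<^sub>R f z)"
proof -
  have "compact (f ` cball 0 R)"
    using f by (intro compact_continuous_image continuous_on_subset[OF f]) auto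
  then obtain B where B: "\<And>z. z \<in> cball 0 R \<Longrightarrow> norm (f z) \<le> B"
    by (meson bounded_iff compact_imp_bounded imageI)
  show ?thesis
  proof (rule integrable_const_bound[where B = "max B 0"])
    show "AE z in V. norm (indicat_real (cball 0 R) z *\<^sub>R f z) \<le> max B 0"
      using B by (auto simp: indicator_def intro!: AE_I2 max.coboundedI1)
    show "(\<lambda>z. indicat_real (cball 0 R) z *\<^sub>R f z) \<in> borel_measurable V"
      using borel_measurable_continuous_onI[OF f]
      by (intro borel_measurable_V borel_measurable_scaleR borel_measurable_indicator) auto
  qed
qed

text \<open>The angle is chosen so that \<tau>^(j-k) = -1. Rotation by \<tau> preserves the measure
  and the ball but changes the sign of the integrand, so the integral equals its own
  negative.\<close>

lemma integral_monomials_eq_0: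
  assumes "j \<noteq> k"
  shows "(\<integral>z. indicat_real (cball 0 R) z *\<^sub>R (z ^ j * cnj z ^ k) \<partial>V) = 0" (is "?I = 0")
proof -
  define \<theta> where "\<theta> = pi / (real j - real k)"
  have jk: "real j - real k \<noteq> 0" using assms by simp
  define \<tau> where "\<tau> = cis \<theta>"
  have \<tau>: "norm \<tau> = 1" unfolding \<tau>_def by simp
  have "\<tau> ^ j * cnj \<tau> ^ k = cis (real j * \<theta> - real k * \<theta>)"
    unfolding \<tau>_def cis_cnj Complex.DeMoivre cis_mult by simp
  also have "real j * \<theta> - real k * \<theta> = pi"
    unfolding \<theta>_def left_diff_distrib[symmetric] using jk by simp
  finally have c: "\<tau> ^ j * cnj \<tau> ^ k = -1" by simp
  have "?I = (\<integral>z. indicat_real (cball 0 R) (\<tau> * z) *\<^sub>R ((\<tau> * z) ^ j * cnj (\<tau> * z) ^ k) \<partial>V)"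
    by (rule integral_rotate[OF \<tau>, symmetric])
      (intro borel_measurable_scaleR borel_measurable_indicator borel_measurable_continuous_onI continuous_intros; simp)
  also have "\<dots> = (\<integral>z. (\<tau> ^ j * cnj \<tau> ^ k) * (indicat_real (cball 0 R) z *\<^sub>R (z ^ j * cnj z ^ k)) \<partial>V)"
    using \<tau> by (intro Bochner_Integration.integral_cong) (auto simp: indicator_def norm_mult power_mult_distrib)
  also have "\<dots> = - ?I" unfolding c by simp
  finally show ?thesis by simp
qed

lemma integral_polynomial_cball:
  "(\<integral>z. indicat_real (cball 0 R) z *\<^sub>R (norm (\<Sum>k<n. a k * z ^ k))\<^sup>2 \<partial>V)
    = (\<Sum>k<n. (norm (a k))\<^sup>2 * (\<integral>z. indicat_real (cball 0 R) z *\<^sub>R norm z ^ (2 * k) \<partial>V))"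
proof -
  define e where "e j k z = indicat_real (cball 0 R) z *\<^sub>R (z ^ j * cnj z ^ k)" for j k and z :: complex
  have int: "integrable V (e j k)" for j k
    unfolding e_def by (rule integrable_cball) (intro continuous_intros)
  have diag: "e k k z = of_real (indicat_real (cball 0 R) z *\<^sub>R norm z ^ (2 * k))" for k z
  proof -
    have "z ^ k * cnj z ^ k = of_real (norm z ^ (2 * k))"
      by (metis complex_norm_square of_real_power power_mult power_mult_distrib)
    then show ?thesis unfolding e_def by (simp add: scaleR_conv_of_real)
  qed
  have "of_real (\<integral>z. indicat_real (cball 0 R) z *\<^sub>R (norm (\<Sum>k<n. a k * z ^ k))\<^sup>2 \<partial>V)
      = (\<integral>z. (\<Sum>j<n. \<Sum>k<n. a j * cnj (a k) * e j k z) \<partial>V)"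
    unfolding integral_complex_of_real[symmetric]
  proof (intro Bochner_Integration.integral_cong refl)
    fix z :: complex
    have "complex_of_real ((norm (\<Sum>k<n. a k * z ^ k))\<^sup>2) = (\<Sum>k<n. a k * z ^ k) * cnj (\<Sum>k<n. a k * z ^ k)"
      by (rule complex_norm_square)
    also have "\<dots> = (\<Sum>j<n. \<Sum>k<n. a j * cnj (a k) * (z ^ j * cnj z ^ k))"
      unfolding cnj_sum sum_product by (simp add: mult_ac)
    finally show "complex_of_real (indicat_real (cball 0 R) z *\<^sub>R (norm (\<Sum>k<n. a k * z ^ k))\<^sup>2)
        = (\<Sum>j<n. \<Sum>k<n. a j * cnj (a k) * e j k z)"
      unfolding e_def by (auto simp: indicator_def)
  qed
  also have "\<dots> = (\<Sum>j<n. \<Sum>k<n. a j * cnj (a k) * (\<integral>z. e j k z \<partial>V))"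
    using int by (simp add: Bochner_Integration.integral_sum)
  also have "\<dots> = (\<Sum>j<n. a j * cnj (a j) * (\<integral>z. e j j z \<partial>V))"
  proof (rule sum.cong[OF refl])
    fix j assume j: "j \<in> {..<n}"
    have "(\<Sum>k<n. a j * cnj (a k) * (\<integral>z. e j k z \<partial>V))
        = (\<Sum>k<n. if k = j then a j * cnj (a j) * (\<integral>z. e j j z \<partial>V) else 0)"
      using integral_monomials_eq_0[of j _ R] by (intro sum.cong) (auto simp: e_def)
    then show "(\<Sum>k<n. a j * cnj (a k) * (\<integral>z. e j k z \<partial>V)) = a j * cnj (a j) * (\<integral>z. e j j z \<partial>V)"
      using j by simp
  qed
  also have "\<dots> = of_real (\<Sum>k<n. (norm (a k))\<^sup>2 * (\<integral>z. indicat_real (cball 0 R) z *\<^sub>R norm z ^ (2 * k) \<partial>V))"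
    unfolding diag integral_complex_of_real complex_norm_square[symmetric] by simp
  finally show ?thesis by (simp only: of_real_eq_iff)
qed

text \<open>On a closed ball of radius R < 1 all partial sums are bounded by the convergent sum of
  |a_k| R^k. Dominated convergence with a constant majorant therefore carries the polynomial
  identity to the limit.\<close>

lemma parseval_cball:
  assumes R: "0 < R" "R < 1" and conv: "\<And>z. norm z < 1 \<Longrightarrow> summable (\<lambda>k. norm (a k * z ^ k))"
  shows "(\<lambda>k. (norm (a k))\<^sup>2 * (\<integral>z. indicat_real (cball 0 R) z *\<^sub>R norm z ^ (2 * k) \<partial>V))
    sums (\<integral>z. indicat_real (cball 0 R) z *\<^sub>R (norm (power_series_on_disk a z))\<^sup>2 \<partial>V)"
proof -
  define p where "p n z = indicat_real (cball 0 R) z *\<^sub>R (norm (\<Sum>k<n. a k * z ^ k))\<^sup>2" for n and z :: complex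
  define f where "f z = indicat_real (cball 0 R) z *\<^sub>R (norm (power_series_on_disk a z))\<^sup>2" for z
  define B where "B = (\<Sum>k. norm (a k) * R ^ k)"
  have sB: "summable (\<lambda>k. norm (a k) * R ^ k)"
    using conv[of "of_real R"] R by (simp add: norm_mult norm_power)
  have p_meas: "p n \<in> borel_measurable V" for n
    unfolding p_def by (rule borel_measurable_V) (intro borel_measurable_scaleR borel_measurable_indicator
      borel_measurable_continuous_onI continuous_intros; simp)
  have lim: "(\<lambda>n. p n z) \<longlonglongrightarrow> f z" if "z \<in> space V" for z
  proof -
    have "summable (\<lambda>k. a k * z ^ k)"
      using conv[of z] that summable_norm_cancel unfolding space_V by auto
    then have "(\<lambda>n. \<Sum>k<n. a k * z ^ k) \<longlonglongrightarrow> power_series_on_disk a z"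
      using that unfolding power_series_on_disk_def space_V by (simp add: summable_LIMSEQ)
    then show ?thesis unfolding p_def f_def by (intro tendsto_intros)
  qed
  have bound: "norm (p n z) \<le> B\<^sup>2" for n z
  proof (cases "z \<in> cball 0 R")
    case True
    have "norm (\<Sum>k<n. a k * z ^ k) \<le> (\<Sum>k<n. norm (a k) * R ^ k)"
      using True by (intro order.trans[OF norm_sum] sum_mono) (auto simp: norm_mult norm_power intro!: mult_left_mono power_mono)
    also have "\<dots> \<le> B" unfolding B_def using R sB by (intro sum_le_suminf) auto
    finally show ?thesis using True unfolding p_def by (simp add: power_mono)
  qed (simp add: p_def)
  have "(\<lambda>n. integral\<^sup>L V (p n)) \<longlonglongrightarrow> integral\<^sup>L V f"
  proof (rule integral_dominated_convergence[where w = "\<lambda>_. B\<^sup>2"])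
    show "f \<in> borel_measurable V"
      by (rule borel_measurable_LIMSEQ_metric[OF p_meas lim])
  qed (use p_meas lim bound in auto)
  then show ?thesis
    unfolding p_def f_def sums_def integral_polynomial_cball .
qed

lemma borel_measurable_power_series:
  assumes conv: "\<And>z. norm z < 1 \<Longrightarrow> summable (\<lambda>k. norm (a k * z ^ k))"
  shows "power_series_on_disk a \<in> borel_measurable V"
proof (rule borel_measurable_LIMSEQ_metric)
  show "(\<lambda>z. \<Sum>k<n. a k * z ^ k) \<in> borel_measurable V" for n
    by (rule borel_measurable_V) (intro borel_measurable_continuous_onI continuous_intros)
  show "(\<lambda>n. \<Sum>k<n. a k * z ^ k) \<longlonglongrightarrow> power_series_on_disk a z" if "z \<in> space V" for z
  proof -
    have "summable (\<lambda>k. a k * z ^ k)"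
      using conv[of z] that summable_norm_cancel unfolding space_V by auto
    then show ?thesis
      using that unfolding power_series_on_disk_def space_V by (simp add: summable_LIMSEQ)
  qed
qed

text \<open>Every point of the open disk eventually lies in the growing closed balls, so this is
  monotone convergence.\<close>

lemma nn_integral_cball_SUP:
  assumes r: "incseq r" "\<And>i. r i < 1" "r \<longlonglongrightarrow> 1" and g: "g \<in> borel_measurable V"
  shows "(\<integral>\<^sup>+z. g z \<partial>V) = (SUP i. \<integral>\<^sup>+z. indicator (cball 0 (r i)) z * g z \<partial>V)"
proof -
  have "(\<integral>\<^sup>+z. g z \<partial>V) = (\<integral>\<^sup>+z. (SUP i. indicator (cball 0 (r i)) z * g z) \<partial>V)"
  proof (rule nn_integral_cong)
    fix z assume z: "z \<in> space V"
    have "eventually (\<lambda>i. norm z < r i) sequentially"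
      using r(3) z unfolding space_V by (intro order_tendstoD(1)[OF r(3)]) auto
    then obtain i where "norm z < r i" by (auto simp: eventually_sequentially)
    then have "g z = indicator (cball 0 (r i)) z * g z" by simp
    also have "\<dots> \<le> (SUP i. indicator (cball 0 (r i)) z * g z)" by (rule SUP_upper) simp
    finally show "g z = (SUP i. indicator (cball 0 (r i)) z * g z)"
      by (intro antisym SUP_least) (auto simp: indicator_def)
  qed
  also have "\<dots> = (SUP i. \<integral>\<^sup>+z. indicator (cball 0 (r i)) z * g z \<partial>V)"
  proof (rule nn_integral_monotone_convergence_SUP)
    show "incseq (\<lambda>i z. indicator (cball 0 (r i)) z * g z)"
      using r(1) by (auto simp: incseq_def le_fun_def indicator_def intro: order.trans)
    show "(\<lambda>z. indicator (cball 0 (r i)) z * g z) \<in> borel_measurable V" for i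
      by (intro borel_measurable_times_ennreal g borel_measurable_V borel_measurable_indicator) simp
  qed
  finally show ?thesis .
qed

lemma integrable_norm_power: "integrable V (\<lambda>z. norm z ^ n)"
proof (rule integrable_const_bound[where B = 1])
  show "AE z in V. norm (norm z ^ n) \<le> 1"
    using space_V by (auto intro!: AE_I2 power_le_one)
  show "(\<lambda>z. norm z ^ n) \<in> borel_measurable V" by (rule borel_measurable_V) measurable
qed

lemma moment_nonneg: "moment V k \<ge> 0"
  unfolding moment_def by (intro integral_nonneg_AE) auto

text \<open>Both sides increase with the radius of the ball, so the supremum over radii can be taken
  on each side. Both may be infinite; this lets the identity be read from the integral to the
  coefficients as well as back.\<close>

lemma nn_integral_parseval:
  assumes conv: "\<And>z. norm z < 1 \<Longrightarrow> summable (\<lambda>k. norm (a k * z ^ k))"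
  shows "(\<integral>\<^sup>+z. ennreal ((norm (power_series_on_disk a z))\<^sup>2) \<partial>V) = (\<Sum>k. ennreal ((norm (a k))\<^sup>2 * moment V k))"
proof -
  define f where "f = power_series_on_disk a"
  obtain r :: "nat \<Rightarrow> real" where r: "incseq r" "\<And>i. 0 < r i" "\<And>i. r i < 1" "r \<longlonglongrightarrow> 1"
    by (rule disk_radius_approx) blast
  define m where "m k i = (\<integral>z. indicat_real (cball 0 (r i)) z *\<^sub>R norm z ^ (2 * k) \<partial>V)" for k i
  have m_nonneg: "m k i \<ge> 0" for k i unfolding m_def by (intro integral_nonneg_AE) auto
  have m: "ennreal (m k i) = (\<integral>\<^sup>+z. indicator (cball 0 (r i)) z * ennreal (norm z ^ (2 * k)) \<partial>V)" for k i
  proof -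
    have "integrable V (\<lambda>z. indicat_real (cball 0 (r i)) z *\<^sub>R norm z ^ (2 * k))"
      by (rule Bochner_Integration.integrable_bound[OF integrable_norm_power[of "2 * k"]])
        (auto simp: indicator_def simp del: scaleR_conv_of_real intro!: borel_measurable_V borel_measurable_scaleR
          borel_measurable_indicator borel_measurable_continuous_onI[of "\<lambda>z. norm z ^ n" for n] continuous_intros)
    then have "ennreal (m k i) = (\<integral>\<^sup>+z. ennreal (indicat_real (cball 0 (r i)) z *\<^sub>R norm z ^ (2 * k)) \<partial>V)"
      unfolding m_def by (subst nn_integral_eq_integral) auto
    also have "\<dots> = (\<integral>\<^sup>+z. indicator (cball 0 (r i)) z * ennreal (norm z ^ (2 * k)) \<partial>V)"
      by (intro nn_integral_cong) (auto simp: indicator_def)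
    finally show ?thesis .
  qed
  have mSUP: "ennreal (moment V k) = (SUP i. ennreal (m k i))" for k
  proof -
    have "ennreal (moment V k) = (\<integral>\<^sup>+z. ennreal (norm z ^ (2 * k)) \<partial>V)"
      unfolding moment_def using integrable_norm_power by (subst nn_integral_eq_integral) auto
    also have "\<dots> = (SUP i. \<integral>\<^sup>+z. indicator (cball 0 (r i)) z * ennreal (norm z ^ (2 * k)) \<partial>V)"
      by (intro nn_integral_cball_SUP r borel_measurable_V) measurable
    finally show ?thesis unfolding m .
  qed
  have m_inc: "incseq (\<lambda>i. ennreal (m k i))" for k
    unfolding m incseq_def using r(1)
    by (intro allI impI nn_integral_mono mult_right_mono) (auto simp: incseq_def indicator_def intro: order.trans)
  have meas: "f \<in> borel_measurable V"
    unfolding f_def by (rule borel_measurable_power_series[OF conv])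
  have ball: "(\<integral>\<^sup>+z. indicator (cball 0 (r i)) z * ennreal ((norm (f z))\<^sup>2) \<partial>V)
      = (\<Sum>k. ennreal ((norm (a k))\<^sup>2 * m k i))" for i
  proof -
    have sB: "summable (\<lambda>k. norm (a k) * r i ^ k)"
      using conv[of "of_real (r i)"] r(2,3)[of i] by (simp add: norm_mult norm_power abs_of_pos)
    have bd: "norm (f z) \<le> (\<Sum>k. norm (a k) * r i ^ k)" if "z \<in> cball 0 (r i)" for z
    proof -
      have z: "norm z < 1" using that r(3)[of i] by simp
      have "norm (f z) \<le> (\<Sum>k. norm (a k * z ^ k))"
        using z summable_norm[OF conv[OF z]] unfolding f_def power_series_on_disk_def by simp
      also have "\<dots> \<le> (\<Sum>k. norm (a k) * r i ^ k)"
        using that by (intro suminf_le conv[OF z] sB) (auto simp: norm_mult norm_power intro!: mult_left_mono power_mono)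
      finally show ?thesis .
    qed
    \<comment> \<open>Integrability on the ball is what allows the Bochner integral in
      \<open>parseval_cball\<close> to be rewritten as a nonnegative integral.\<close>
    have "integrable V (\<lambda>z. indicat_real (cball 0 (r i)) z *\<^sub>R (norm (f z))\<^sup>2)"
    proof (rule integrable_const_bound[where B = "(\<Sum>k. norm (a k) * r i ^ k)\<^sup>2"])
      show "AE z in V. norm (indicat_real (cball 0 (r i)) z *\<^sub>R (norm (f z))\<^sup>2) \<le> (\<Sum>k. norm (a k) * r i ^ k)\<^sup>2"
        using bd by (auto simp: indicator_def intro!: AE_I2 power_mono)
      show "(\<lambda>z. indicat_real (cball 0 (r i)) z *\<^sub>R (norm (f z))\<^sup>2) \<in> borel_measurable V"
      proof -
        have "indicat_real (cball 0 (r i)) \<in> borel_measurable V"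
          by (intro borel_measurable_V borel_measurable_indicator) simp
        then show ?thesis using meas by measurable
      qed
    qed
    then have "ennreal (\<integral>z. indicat_real (cball 0 (r i)) z *\<^sub>R (norm (f z))\<^sup>2 \<partial>V)
        = (\<integral>\<^sup>+z. ennreal (indicat_real (cball 0 (r i)) z *\<^sub>R (norm (f z))\<^sup>2) \<partial>V)"
      by (subst nn_integral_eq_integral) auto
    also have "\<dots> = (\<integral>\<^sup>+z. indicator (cball 0 (r i)) z * ennreal ((norm (f z))\<^sup>2) \<partial>V)"
      by (intro nn_integral_cong) (auto simp: indicator_def)
    finally have "(\<integral>\<^sup>+z. indicator (cball 0 (r i)) z * ennreal ((norm (f z))\<^sup>2) \<partial>V)
        = ennreal (\<integral>z. indicat_real (cball 0 (r i)) z *\<^sub>R (norm (f z))\<^sup>2 \<partial>V)" by simp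
    also have "\<dots> = (\<Sum>k. ennreal ((norm (a k))\<^sup>2 * m k i))"
      using parseval_cball[OF r(2,3)[of i] conv, folded f_def m_def] m_nonneg
      by (subst suminf_ennreal2) (auto simp: sums_iff)
    finally show ?thesis .
  qed
  have "(\<integral>\<^sup>+z. ennreal ((norm (f z))\<^sup>2) \<partial>V)
      = (SUP i. \<integral>\<^sup>+z. indicator (cball 0 (r i)) z * ennreal ((norm (f z))\<^sup>2) \<partial>V)"
    using meas by (intro nn_integral_cball_SUP r) measurable
  also have "\<dots> = (SUP i. \<Sum>k. ennreal ((norm (a k))\<^sup>2 * m k i))" unfolding ball ..
  \<comment> \<open>Supremum and series may be exchanged because each term increases with the
    radius.\<close>
  also have "\<dots> = (\<Sum>k. SUP i. ennreal ((norm (a k))\<^sup>2 * m k i))"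
  proof (rule ennreal_suminf_SUP_eq[symmetric])
    show "incseq (\<lambda>i. ennreal ((norm (a k))\<^sup>2 * m k i))" for k
      using m_inc[of k] m_nonneg unfolding incseq_def by (auto intro!: ennreal_leI mult_left_mono)
  qed
  also have "\<dots> = (\<Sum>k. ennreal ((norm (a k))\<^sup>2 * moment V k))"
    by (simp add: ennreal_mult m_nonneg moment_nonneg mSUP SUP_mult_left_ennreal)
  finally show ?thesis unfolding f_def .
qed

end

lemma summable_weighted_square_add:
  fixes a b :: "nat \<Rightarrow> complex" and m :: "nat \<Rightarrow> real"
  assumes "summable (\<lambda>k. (norm (a k))\<^sup>2 * m k)" "summable (\<lambda>k. (norm (b k))\<^sup>2 * m k)" "\<And>k. m k \<ge> 0"
  shows "summable (\<lambda>k. norm (a k + c * b k) ^ 2 * m k)"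
proof (rule summable_comparison_test)
  show "summable (\<lambda>k. 2 * ((norm (a k))\<^sup>2 * m k) + 2 * (norm c)\<^sup>2 * ((norm (b k))\<^sup>2 * m k))"
    using assms by (intro summable_add summable_mult)
  have "(norm (x + c * y))\<^sup>2 \<le> 2 * (norm x)\<^sup>2 + 2 * (norm c)\<^sup>2 * (norm y)\<^sup>2" for x y :: complex
  proof -
    have "(norm (x + c * y))\<^sup>2 \<le> (norm x + norm (c * y))\<^sup>2"
      by (intro power_mono norm_triangle_ineq) auto
    also have "\<dots> \<le> 2 * (norm x)\<^sup>2 + 2 * (norm (c * y))\<^sup>2"
      using sum_squares_bound[of "norm x" "norm (c * y)"] by (simp add: power2_sum)
    finally show ?thesis by (simp add: norm_mult power_mult_distrib)
  qed
  then have "(norm (a k + c * b k))\<^sup>2 * m k \<le> (2 * (norm (a k))\<^sup>2 + 2 * (norm c)\<^sup>2 * (norm (b k))\<^sup>2) * m k" for k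
    by (intro mult_right_mono assms(3))
  then   show "\<exists>N. \<forall>k\<ge>N. norm (norm (a k + c * b k) ^ 2 * m k)
      \<le> 2 * ((norm (a k))\<^sup>2 * m k) + 2 * (norm c)\<^sup>2 * ((norm (b k))\<^sup>2 * m k)"
    using assms(3) by (auto simp: abs_mult algebra_simps)
qed

text \<open>The form \<open>a k + c * b k\<close> serves linearity of the operator as well as the
  sequences with c = i^j that occur in polarization.\<close>

lemma bergman_coeffs_add:
  assumes "a \<in> bergman_coeffs" "b \<in> bergman_coeffs"
  shows "(\<lambda>k. a k + c * b k) \<in> bergman_coeffs"
  using summable_weighted_square_add[of a "\<lambda>k. 1 / (real k + 1)" b c] assms
  by (simp add: bergman_coeffs_def)

lemma power_series_on_disk_add:
  assumes "a \<in> bergman_coeffs" "b \<in> bergman_coeffs"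
  shows "power_series_on_disk (\<lambda>k. a k + c * b k) z
    = power_series_on_disk a z + c * power_series_on_disk b z"
proof (cases "z \<in> \<D>")
  case True
  then have s: "summable (\<lambda>k. a k * z ^ k)" "summable (\<lambda>k. b k * z ^ k)"
    using assms[THEN bergman_coeffs_summable, of z, THEN summable_norm_cancel] by auto
  have "(\<Sum>k. (a k + c * b k) * z ^ k) = (\<Sum>k. a k * z ^ k + c * (b k * z ^ k))"
    by (simp add: algebra_simps)
  also have "\<dots> = (\<Sum>k. a k * z ^ k) + c * (\<Sum>k. b k * z ^ k)"
    using s by (subst suminf_add[symmetric]) (auto intro: summable_mult simp: suminf_mult)
  finally show ?thesis using True unfolding power_series_on_disk_def by simp
qed (simp add: power_series_on_disk_def)

text \<open>The bound on the moments makes \<open>V\<close> a Carleson measure for the Bergman space.\<close>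

locale carleson_rotation_invariant = rotation_invariant +
  fixes C :: real
  assumes moment_le: "moment V k \<le> C / (real k + 1)"
begin

lemma summable_coeffs_moment:
  assumes "a \<in> bergman_coeffs"
  shows "summable (\<lambda>k. (norm (a k))\<^sup>2 * moment V k)"
proof (rule summable_comparison_test)
  show "summable (\<lambda>k. C * ((norm (a k))\<^sup>2 / (real k + 1)))"
    using assms unfolding bergman_coeffs_def by (intro summable_mult) simp
  show "\<exists>N. \<forall>k\<ge>N. norm ((norm (a k))\<^sup>2 * moment V k) \<le> C * ((norm (a k))\<^sup>2 / (real k + 1))"
    using mult_left_mono[OF moment_le, of "(norm (a k))\<^sup>2" k for k] moment_nonneg
    by (auto simp: abs_mult mult_ac)
qed

text \<open>The moment bound compares the series with the one defining
  \<open>bergman_coeffs\<close>. Its sum is thus finite, and the \<open>ennreal\<close> version of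
  Parseval becomes a statement about convergent integrals.\<close>

lemma
  assumes a: "a \<in> bergman_coeffs"
  shows integrable_square: "integrable V (\<lambda>z. (norm (power_series_on_disk a z))\<^sup>2)"
    and parseval: "(\<lambda>k. (norm (a k))\<^sup>2 * moment V k) sums (\<integral>z. (norm (power_series_on_disk a z))\<^sup>2 \<partial>V)"
proof -
  note s = summable_coeffs_moment[OF a]
  have "(\<integral>\<^sup>+z. ennreal ((norm (power_series_on_disk a z))\<^sup>2) \<partial>V)
      = (\<Sum>k. ennreal ((norm (a k))\<^sup>2 * moment V k))"
    by (rule nn_integral_parseval[OF bergman_coeffs_summable[OF a]])
  also have "\<dots> = ennreal (\<Sum>k. (norm (a k))\<^sup>2 * moment V k)"
    using s moment_nonneg by (intro suminf_ennreal2) auto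
  finally have *: "(\<integral>\<^sup>+z. ennreal ((norm (power_series_on_disk a z))\<^sup>2) \<partial>V)
      = ennreal (\<Sum>k. (norm (a k))\<^sup>2 * moment V k)" .
  have m: "(\<lambda>z. (norm (power_series_on_disk a z))\<^sup>2) \<in> borel_measurable V"
    using borel_measurable_power_series[OF bergman_coeffs_summable[OF a]] by measurable
  have n: "0 \<le> (\<Sum>k. (norm (a k))\<^sup>2 * moment V k)"
    using s moment_nonneg by (intro suminf_nonneg) auto
  show "integrable V (\<lambda>z. (norm (power_series_on_disk a z))\<^sup>2)"
    using * m by (intro integrableI_nonneg) auto
  have "(\<integral>z. (norm (power_series_on_disk a z))\<^sup>2 \<partial>V) = (\<Sum>k. (norm (a k))\<^sup>2 * moment V k)"
    by (rule integral_eq_nn_integral[THEN trans]) (use * m n in auto)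
  then show "(\<lambda>k. (norm (a k))\<^sup>2 * moment V k) sums (\<integral>z. (norm (power_series_on_disk a z))\<^sup>2 \<partial>V)"
    using s by (simp add: sums_iff)
qed

lemma
  assumes a: "a \<in> bergman_coeffs" and b: "b \<in> bergman_coeffs"
  shows integrable_inner: "integrable V (\<lambda>z. power_series_on_disk a z * cnj (power_series_on_disk b z))"
    and parseval_inner: "(\<lambda>k. a k * cnj (b k) * of_real (moment V k)) sums
      (\<integral>z. power_series_on_disk a z * cnj (power_series_on_disk b z) \<partial>V)"
proof -
  \<comment> \<open>The polarization identity. It is used twice: pointwise on the values of the two
    series, and below on their coefficients.\<close>
  have pol: "x * cnj y = (\<Sum>j<4. (\<i> ^ j / 4) * of_real ((norm (x + \<i> ^ j * y))\<^sup>2))" for x y :: complex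
    by (simp add: complex_eq_iff lessThan_nat_numeral cmod_power2 power3_eq_cube)
      (simp add: power2_eq_square field_simps)
  define q where "q j = (\<integral>z. (norm (power_series_on_disk (\<lambda>k. a k + \<i> ^ j * b k) z))\<^sup>2 \<partial>V)" for j :: nat
  have int: "integrable V (\<lambda>z. (\<i> ^ j / 4) * complex_of_real ((norm (power_series_on_disk (\<lambda>k. a k + \<i> ^ j * b k) z))\<^sup>2))" for j :: nat
    using integrable_square[OF bergman_coeffs_add[OF a b]] by (intro integrable_mult_right integrable_of_real)
  have eq: "power_series_on_disk a z * cnj (power_series_on_disk b z)
      = (\<Sum>j<4. (\<i> ^ j / 4) * of_real ((norm (power_series_on_disk (\<lambda>k. a k + \<i> ^ j * b k) z))\<^sup>2))" for z
    unfolding power_series_on_disk_add[OF a b] by (rule pol)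
  show "integrable V (\<lambda>z. power_series_on_disk a z * cnj (power_series_on_disk b z))"
    unfolding eq by (intro Bochner_Integration.integrable_sum int)
  have "(\<lambda>k. \<Sum>j<4. (\<i> ^ j / 4) * of_real ((norm (a k + \<i> ^ j * b k))\<^sup>2 * moment V k)) sums (\<Sum>j<4. (\<i> ^ j / 4) * of_real (q j))"
    unfolding q_def by (intro sums_sum sums_mult sums_of_real parseval bergman_coeffs_add a b)
  also have "(\<lambda>k. \<Sum>j<4. (\<i> ^ j / 4) * of_real ((norm (a k + \<i> ^ j * b k))\<^sup>2 * moment V k))
      = (\<lambda>k. a k * cnj (b k) * of_real (moment V k))"
    unfolding pol[of "a k" "b k" for k] sum_distrib_right of_real_mult by (simp only: mult.assoc)
  also have "(\<Sum>j<4. (\<i> ^ j / 4) * of_real (q j)) = (\<integral>z. power_series_on_disk a z * cnj (power_series_on_disk b z) \<partial>V)"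
    unfolding eq q_def using int
    by (subst Bochner_Integration.integral_sum) (auto simp del: of_real_power)
  finally show "(\<lambda>k. a k * cnj (b k) * of_real (moment V k)) sums
      (\<integral>z. power_series_on_disk a z * cnj (power_series_on_disk b z) \<partial>V)" .
qed

end

section \<open>Area measure on the disk\<close>

lemma nn_integral_lborel_plus:
  fixes f :: "'a::euclidean_space \<Rightarrow> ennreal"
  assumes "f \<in> borel_measurable borel"
  shows "(\<integral>\<^sup>+x. f (x + c) \<partial>lborel) = (\<integral>\<^sup>+x. f x \<partial>lborel)"
proof -
  have "(\<integral>\<^sup>+x. f x \<partial>lborel) = (\<integral>\<^sup>+x. f x \<partial>distr lborel borel ((+) c))"
    by (simp add: lborel_distr_plus)
  also have "\<dots> = (\<integral>\<^sup>+x. f (c + x) \<partial>lborel)"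
    using assms by (subst nn_integral_distr) auto
  finally show ?thesis by (simp add: add.commute)
qed

text \<open>
  Uniqueness of the translation invariant measure, specialised: integrating
  \<open>1\<^sub>A(x) 1\<^sub>B(x - \<tau>y)\<close> over \<open>x\<close> and \<open>y\<close> in both orders,
  with \<open>B\<close> the rotation invariant unit ball, compares \<open>A\<close> with its preimage.
\<close>

lemma distr_lborel_rotate:
  fixes \<tau> :: complex
  assumes \<tau>: "norm \<tau> = 1"
  shows "distr lborel borel (\<lambda>z. \<tau> * z) = lborel"
proof (rule measure_eqI)
  have \<tau>0: "\<tau> \<noteq> 0" using \<tau> by auto
  fix A :: "complex set" assume "A \<in> sets (distr lborel borel (\<lambda>z. \<tau> * z))"
  then have [measurable]: "A \<in> sets borel" by simp
  define B :: "complex set" where "B = ball 0 1"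
  have [measurable]: "B \<in> sets borel" unfolding B_def by simp
  have mu: "emeasure (distr lborel borel (\<lambda>z. \<tau> * z)) A = (\<integral>\<^sup>+y. indicator A (\<tau> * y) \<partial>lborel)"
    by (subst nn_integral_indicator[symmetric], simp, subst nn_integral_distr) auto
  have B1: "(\<integral>\<^sup>+y. indicator B (x - \<tau> * y) \<partial>lborel) = emeasure lborel B" for x
  proof -
    \<comment> \<open>Shifting y by x/\<tau> turns x - \<tau>y into -\<tau>y, which has the same
      modulus as y and hence lies in the unit ball exactly when y does.\<close>
    have "(\<integral>\<^sup>+y. indicator B (x - \<tau> * y) \<partial>lborel) = (\<integral>\<^sup>+y. indicator B (x - \<tau> * (y + x / \<tau>)) \<partial>lborel)"
      by (rule nn_integral_lborel_plus[symmetric]) measurable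
    also have "\<dots> = (\<integral>\<^sup>+y. indicator B y \<partial>lborel)"
      using \<tau> \<tau>0 by (intro nn_integral_cong) (simp add: B_def indicator_def distrib_left norm_mult)
    finally show ?thesis by simp
  qed
  have A1: "(\<integral>\<^sup>+y. indicator A (x + \<tau> * y) \<partial>lborel) = (\<integral>\<^sup>+y. indicator A (\<tau> * y) \<partial>lborel)" for x
  proof -
    have "(\<integral>\<^sup>+y. indicator A (\<tau> * y) \<partial>lborel) = (\<integral>\<^sup>+y. indicator A (\<tau> * (y + x / \<tau>)) \<partial>lborel)"
      by (rule nn_integral_lborel_plus[symmetric]) measurable
    then show ?thesis using \<tau>0 by (simp add: distrib_left add.commute)
  qed
  have "emeasure lborel A * emeasure lborel B
      = (\<integral>\<^sup>+x. indicator A x * (\<integral>\<^sup>+y. indicator B (x - \<tau> * y) \<partial>lborel) \<partial>lborel)"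
    unfolding B1 by (simp add: nn_integral_multc)
  also have "\<dots> = (\<integral>\<^sup>+x. \<integral>\<^sup>+y. indicator A x * indicator B (x - \<tau> * y) \<partial>lborel \<partial>lborel)"
    by (intro nn_integral_cong nn_integral_cmult[symmetric]) measurable
  also have "\<dots> = (\<integral>\<^sup>+y. \<integral>\<^sup>+x. indicator A x * indicator B (x - \<tau> * y) \<partial>lborel \<partial>lborel)"
    by (rule lborel_pair.Fubini') measurable
  also have "\<dots> = (\<integral>\<^sup>+y. \<integral>\<^sup>+x. indicator A (x + \<tau> * y) * indicator B x \<partial>lborel \<partial>lborel)"
  proof (rule nn_integral_cong)
    fix y
    have "(\<integral>\<^sup>+x. indicator A x * indicator B (x - \<tau> * y) \<partial>lborel)
      = (\<integral>\<^sup>+x. indicator A (x + \<tau> * y) * indicator B (x + \<tau> * y - \<tau> * y) \<partial>lborel)"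
      by (rule nn_integral_lborel_plus[symmetric]) measurable
    then show "(\<integral>\<^sup>+x. indicator A x * indicator B (x - \<tau> * y) \<partial>lborel)
      = (\<integral>\<^sup>+x. indicator A (x + \<tau> * y) * indicator B x \<partial>lborel)" by simp
  qed
  also have "\<dots> = (\<integral>\<^sup>+x. \<integral>\<^sup>+y. indicator A (x + \<tau> * y) * indicator B x \<partial>lborel \<partial>lborel)"
    by (rule lborel_pair.Fubini') measurable
  also have "\<dots> = (\<integral>\<^sup>+x. (\<integral>\<^sup>+y. indicator A (\<tau> * y) \<partial>lborel) * indicator B x \<partial>lborel)"
    by (intro nn_integral_cong) (simp add: nn_integral_multc A1)
  also have "\<dots> = (\<integral>\<^sup>+y. indicator A (\<tau> * y) \<partial>lborel) * emeasure lborel B"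
    by (simp add: nn_integral_cmult)
  finally have "emeasure lborel A * emeasure lborel B
    = (\<integral>\<^sup>+y. indicator A (\<tau> * y) \<partial>lborel) * emeasure lborel B" .
  \<comment> \<open>The mass of the ball is finite and nonzero, so it can be cancelled from both
    sides.\<close>
  moreover have "emeasure lborel B = ennreal pi"
    unfolding B_def by (simp add: emeasure_ball unit_ball_vol_2)
  ultimately show "emeasure (distr lborel borel (\<lambda>z. \<tau> * z)) A = emeasure lborel A"
    unfolding mu by (simp add: mult.commute[of _ "ennreal pi"] ennreal_mult_cancel_left)
qed simp

section \<open>Power moments computed from the masses of superlevel sets\<close>

text \<open>Write \<rho>^(n+1) as the integral of (n+1) s^n over 0 \<le> s \<le> \<rho> and exchange
  the two integrations. The exponent 0 has no such representation, which is the reason for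
  \<open>Suc n\<close>.\<close>

lemma nn_integral_power_layer_cake:
  fixes \<rho> :: "'a \<Rightarrow> real"
  assumes "sigma_finite_measure M" and \<rho>[measurable]: "\<rho> \<in> borel_measurable M"
    and range: "\<And>x. x \<in> space M \<Longrightarrow> 0 \<le> \<rho> x \<and> \<rho> x \<le> 1"
  shows "(\<integral>\<^sup>+x. ennreal (\<rho> x ^ Suc n) \<partial>M)
    = (\<integral>\<^sup>+s. ennreal (real (Suc n) * s ^ n) * indicator {0..1} s * emeasure M {x \<in> space M. s \<le> \<rho> x} \<partial>lborel)"
proof -
  interpret sigma_finite_measure M by fact
  interpret pair_sigma_finite M "lborel :: real measure" ..
  have "(\<integral>\<^sup>+x. ennreal (\<rho> x ^ Suc n) \<partial>M)
      = (\<integral>\<^sup>+x. \<integral>\<^sup>+s. ennreal (real (Suc n) * s ^ n) * indicator {0..1} s * (if s \<le> \<rho> x then 1 else 0) \<partial>lborel \<partial>M)"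
  proof (rule nn_integral_cong)
    fix x assume "x \<in> space M"
    then have x: "0 \<le> \<rho> x" "\<rho> x \<le> 1" using range by auto
    have "(\<integral>\<^sup>+s. ennreal (real (Suc n) * s ^ n) * indicator {0..\<rho> x} s \<partial>lborel) = \<rho> x ^ Suc n - 0 ^ Suc n"
    proof (rule nn_integral_FTC_Icc[where F = "\<lambda>s. s ^ Suc n"])
      show "DERIV (\<lambda>s. s ^ Suc n) s :> real (Suc n) * s ^ n" for s :: real
        using DERIV_pow[of "Suc n" s] by simp
    qed (use x in auto)
    also have "(\<lambda>s. ennreal (real (Suc n) * s ^ n) * indicator {0..\<rho> x} s)
      = (\<lambda>s. ennreal (real (Suc n) * s ^ n) * indicator {0..1} s * (if s \<le> \<rho> x then 1 else 0))"
      using x by (auto simp: indicator_def fun_eq_iff)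
    finally show "ennreal (\<rho> x ^ Suc n) = (\<integral>\<^sup>+s. ennreal (real (Suc n) * s ^ n) * indicator {0..1} s * (if s \<le> \<rho> x then 1 else 0) \<partial>lborel)"
      by simp
  qed
  also have "\<dots> = (\<integral>\<^sup>+s. \<integral>\<^sup>+x. ennreal (real (Suc n) * s ^ n) * indicator {0..1} s * (if s \<le> \<rho> x then 1 else 0) \<partial>M \<partial>lborel)"
    by (rule Fubini'[symmetric]) measurable
  also have "\<dots> = (\<integral>\<^sup>+s. ennreal (real (Suc n) * s ^ n) * indicator {0..1} s * emeasure M {x \<in> space M. s \<le> \<rho> x} \<partial>lborel)"
  proof (rule nn_integral_cong)
    fix s :: real
    have "(\<integral>\<^sup>+x. ennreal (real (Suc n) * s ^ n) * indicator {0..1} s * (if s \<le> \<rho> x then 1 else 0) \<partial>M)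
        = ennreal (real (Suc n) * s ^ n) * indicator {0..1} s * (\<integral>\<^sup>+x. (if s \<le> \<rho> x then 1 else 0) \<partial>M)"
      by (rule nn_integral_cmult) measurable
    also have "(\<integral>\<^sup>+x. (if s \<le> \<rho> x then 1 else 0) \<partial>M) = (\<integral>\<^sup>+x. indicator {x \<in> space M. s \<le> \<rho> x} x \<partial>M)"
      by (intro nn_integral_cong) (auto simp: indicator_def)
    also have "\<dots> = emeasure M {x \<in> space M. s \<le> \<rho> x}"
      by (rule nn_integral_indicator) measurable
    finally show "(\<integral>\<^sup>+x. ennreal (real (Suc n) * s ^ n) * indicator {0..1} s * (if s \<le> \<rho> x then 1 else 0) \<partial>M)
      = ennreal (real (Suc n) * s ^ n) * indicator {0..1} s * emeasure M {x \<in> space M. s \<le> \<rho> x}" .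
  qed
  finally show ?thesis .
qed

lemma nn_integral_power_quadratic:
  assumes "c \<ge> 0"
  shows "(\<integral>\<^sup>+s. ennreal (real (Suc n) * s ^ n) * indicator {0..1} s * ennreal (c * (1 - s\<^sup>2)) \<partial>lborel)
    = ennreal (2 * c / (real (Suc n) + 2))"
proof -
  \<comment> \<open>An antiderivative of (n+1) s^n c (1 - s^2); its value at 1 is c - c(n+1)/(n+3) =
    2c/(n+3).\<close>
  define F where "F s = c * s ^ Suc n - c * real (Suc n) / (real (Suc n) + 2) * s ^ (Suc n + 2)" for s :: real
  have "(\<integral>\<^sup>+s. ennreal (real (Suc n) * s ^ n) * indicator {0..1} s * ennreal (c * (1 - s\<^sup>2)) \<partial>lborel)
      = (\<integral>\<^sup>+s. ennreal (real (Suc n) * s ^ n * (c * (1 - s\<^sup>2))) * indicator {0..1} s \<partial>lborel)"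
    using assms by (intro nn_integral_cong) (auto simp: indicator_def ennreal_mult' power_le_one)
  also have "\<dots> = F 1 - F 0"
  proof (rule nn_integral_FTC_Icc[where F = F])
    show "DERIV F s :> real (Suc n) * s ^ n * (c * (1 - s\<^sup>2))" for s
    proof -
      have "DERIV F s :> c * (real (Suc n) * s ^ n) - c * real (Suc n) / (real (Suc n) + 2) * (real (Suc n + 2) * s ^ (Suc n + 2 - 1))"
        unfolding F_def
        by (intro DERIV_diff DERIV_cmult) (use DERIV_pow[of "Suc n" s] DERIV_pow[of "Suc n + 2" s] in auto)
      moreover have "c * real (Suc n) / (real (Suc n) + 2) * (real (Suc n + 2) * s ^ (Suc n + 2 - 1))
          = c * real (Suc n) * s ^ (n + 2)"
        by (simp add: field_simps)
      ultimately show ?thesis by (simp add: algebra_simps power_add power2_eq_square)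
    qed
    show "0 \<le> real (Suc n) * s ^ n * (c * (1 - s\<^sup>2))" if "s \<in> {0..1}" for s
      using that assms by (intro mult_nonneg_nonneg) (auto simp: power_le_one)
  qed auto
  also have "F 1 - F 0 = 2 * c / (real (Suc n) + 2)"
    unfolding F_def by (simp add: field_simps)
  finally show ?thesis .
qed

text \<open>The profile c(1 - s^2) is the tail of area measure, where it holds with equality and c =
  \<pi>; for the measures on [0,1) it is the assumed upper bound. For m = 2k the right-hand side
  becomes c/(k+1).\<close>

lemma
  fixes \<rho> :: "'a \<Rightarrow> real"
  assumes "finite_measure M" and \<rho>: "\<rho> \<in> borel_measurable M"
    and range: "\<And>x. x \<in> space M \<Longrightarrow> 0 \<le> \<rho> x \<and> \<rho> x < 1" and c: "c \<ge> 0"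
  shows integral_power_le_of_tail: "(\<And>s. 0 \<le> s \<Longrightarrow> s < 1 \<Longrightarrow> measure M {x \<in> space M. s \<le> \<rho> x} \<le> c * (1 - s\<^sup>2))
      \<Longrightarrow> (\<integral>x. \<rho> x ^ m \<partial>M) \<le> 2 * c / (real m + 2)" (is "PROP ?A \<Longrightarrow> ?B")
    and integral_power_eq_of_tail: "(\<And>s. 0 \<le> s \<Longrightarrow> s < 1 \<Longrightarrow> measure M {x \<in> space M. s \<le> \<rho> x} = c * (1 - s\<^sup>2))
      \<Longrightarrow> (\<integral>x. \<rho> x ^ m \<partial>M) = 2 * c / (real m + 2)" (is "PROP ?C \<Longrightarrow> ?D")
proof -
  interpret finite_measure M by fact
  \<comment> \<open>The tail hypothesis covers s < 1 only, while the layer cake integral also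
    contains s = 1. The superlevel set there is empty because \<rho> < 1.\<close>
  have sp: "{x \<in> space M. 0 \<le> \<rho> x} = space M" and one: "{x \<in> space M. s \<le> \<rho> x} = {}" if "s \<ge> 1" for s
    using range that by force+
  have int: "integrable M (\<lambda>x. \<rho> x ^ m)" for m
    using \<rho> range by (intro integrable_const_bound[where B = 1]) (auto intro!: AE_I2 power_le_one simp: abs_le_iff less_imp_le)
  have nn: "ennreal (\<integral>x. \<rho> x ^ Suc n \<partial>M) = (\<integral>\<^sup>+s. ennreal (real (Suc n) * s ^ n) * indicator {0..1} s
      * emeasure M {x \<in> space M. s \<le> \<rho> x} \<partial>lborel)" for n
  proof -
    have "ennreal (\<integral>x. \<rho> x ^ Suc n \<partial>M) = (\<integral>\<^sup>+x. ennreal (\<rho> x ^ Suc n) \<partial>M)"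
      using range by (intro nn_integral_eq_integral[symmetric] int) (auto intro!: AE_I2)
    then show ?thesis
      using range by (subst (asm) nn_integral_power_layer_cake)
        (auto intro!: \<rho> sigma_finite_measure_axioms less_imp_le)
  qed
  show ?B if le: "PROP ?A"
  \<comment> \<open>For m = 0 the integral is the total mass, and the tail bound at s = 0 already
    gives c = 2c/(0+2).\<close>
  proof (cases m)
    case 0
    then show ?thesis using le[of 0] sp[of 1] by simp
  next
    case (Suc n)
    have "ennreal (\<integral>x. \<rho> x ^ Suc n \<partial>M) \<le> (\<integral>\<^sup>+s. ennreal (real (Suc n) * s ^ n) * indicator {0..1} s
        * ennreal (c * (1 - s\<^sup>2)) \<partial>lborel)"
      unfolding nn
    proof (rule nn_integral_mono)
      fix s :: real
      have "emeasure M {x \<in> space M. s \<le> \<rho> x} \<le> ennreal (c * (1 - s\<^sup>2))" if "0 \<le> s" "s \<le> 1"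
        using le[of s] that by (cases "s < 1") (auto simp: one emeasure_eq_measure intro!: ennreal_leI)
      then show "ennreal (real (Suc n) * s ^ n) * indicator {0..1} s * emeasure M {x \<in> space M. s \<le> \<rho> x}
          \<le> ennreal (real (Suc n) * s ^ n) * indicator {0..1} s * ennreal (c * (1 - s\<^sup>2))"
        by (cases "0 \<le> s \<and> s \<le> 1") (auto simp: indicator_def intro!: mult_left_mono)
    qed
    then show ?thesis using c Suc by (subst (asm) nn_integral_power_quadratic) (auto simp: ennreal_le_iff)
  qed
  show ?D if eq: "PROP ?C"
  proof (cases m)
    case 0
    then show ?thesis using eq[of 0] sp[of 1] by simp
  next
    case (Suc n)
    have "ennreal (\<integral>x. \<rho> x ^ Suc n \<partial>M) = (\<integral>\<^sup>+s. ennreal (real (Suc n) * s ^ n) * indicator {0..1} s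
        * ennreal (c * (1 - s\<^sup>2)) \<partial>lborel)"
      unfolding nn
    proof (rule nn_integral_cong)
      fix s :: real
      have "emeasure M {x \<in> space M. s \<le> \<rho> x} = ennreal (c * (1 - s\<^sup>2))" if "0 \<le> s" "s \<le> 1"
        using eq[of s] that by (cases "s < 1") (auto simp: one emeasure_eq_measure)
      then show "ennreal (real (Suc n) * s ^ n) * indicator {0..1} s * emeasure M {x \<in> space M. s \<le> \<rho> x}
          = ennreal (real (Suc n) * s ^ n) * indicator {0..1} s * ennreal (c * (1 - s\<^sup>2))"
        by (cases "0 \<le> s \<and> s \<le> 1") (auto simp: indicator_def)
    qed
    moreover have "0 \<le> (\<integral>x. \<rho> x ^ Suc n \<partial>M)"
      using range by (intro integral_nonneg_AE) (auto intro!: AE_I2)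
    ultimately show ?thesis using c Suc by (subst (asm) nn_integral_power_quadratic) (auto simp: ennreal_inj)
  qed
qed

abbreviation lborel_disk :: "complex measure" where
  "lborel_disk \<equiv> restrict_space lborel \<D>"

lemma rotation_invariant_lborel_disk: "rotation_invariant lborel_disk"
proof -
  have sets: "sets lborel_disk = sets borel_disk" by (rule sets_restrict_space_cong) simp
  have "finite_measure lborel_disk"
    by (rule finite_measureI) (simp add: space_restrict_space emeasure_restrict_space emeasure_ball)
  then interpret finite_measure lborel_disk .
  show ?thesis
  proof
    show "sets lborel_disk = sets borel_disk" by (rule sets)
    fix \<tau> :: complex assume \<tau>: "norm \<tau> = 1"
    have m: "(\<lambda>z. \<tau> * z) \<in> measurable lborel_disk lborel_disk"
      by (rule measurable_restrict_space3) (auto simp: norm_mult \<tau>)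
    show "distr lborel_disk lborel_disk (\<lambda>z. \<tau> * z) = lborel_disk"
    proof (rule measure_eqI)
      fix Z assume "Z \<in> sets (distr lborel_disk lborel_disk (\<lambda>z. \<tau> * z))"
      then have Z: "Z \<in> sets lborel_disk" by simp
      then have ZD: "Z \<subseteq> \<D>" and [measurable]: "Z \<in> sets borel"
        by (auto simp: sets_restrict_space)
      have sub: "(\<lambda>z. \<tau> * z) -` Z \<subseteq> \<D>"
        using ZD \<tau> by (force simp: norm_mult)
      then have "emeasure (distr lborel_disk lborel_disk (\<lambda>z. \<tau> * z)) Z = emeasure lborel ((\<lambda>z. \<tau> * z) -` Z)"
        using m Z by (simp add: emeasure_distr space_restrict_space emeasure_restrict_space Int_absorb2)
      also have "\<dots> = emeasure (distr lborel borel (\<lambda>z. \<tau> * z)) Z"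
        by (subst emeasure_distr) auto
      also have "\<dots> = emeasure lborel_disk Z"
        using ZD unfolding distr_lborel_rotate[OF \<tau>] by (simp add: emeasure_restrict_space)
      finally show "emeasure (distr lborel_disk lborel_disk (\<lambda>z. \<tau> * z)) Z = emeasure lborel_disk Z" .
    qed simp
  qed
qed

interpretation disk: rotation_invariant lborel_disk
  by (rule rotation_invariant_lborel_disk)

text \<open>The annulus s \<le> |z| < 1 has area \<pi>(1 - s^2), so the equality case of the tail
  lemma applies with \<rho> the modulus and replaces polar coordinates.\<close>

lemma moment_lborel_disk: "moment lborel_disk k = pi / (real k + 1)"
proof -
  have "moment lborel_disk k = 2 * pi / (real (2 * k) + 2)"
    unfolding moment_def
  proof (rule integral_power_eq_of_tail)
    show "norm \<in> borel_measurable lborel_disk" by (intro disk.borel_measurable_V) simp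
    show "measure lborel_disk {x \<in> space lborel_disk. s \<le> norm x} = pi * (1 - s\<^sup>2)" if "0 \<le> s" "s < 1" for s
    proof -
      have "measure lborel_disk {x \<in> space lborel_disk. s \<le> norm x} = measure lborel (\<D> - ball 0 s)"
        by (subst measure_restrict_space) (auto simp: space_restrict_space intro!: arg_cong[where f = "measure lborel"])
      also have "\<dots> = measure lborel \<D> - measure lborel (ball (0::complex) s)"
        using that by (intro measure_Diff) (auto simp: emeasure_ball)
      also have "\<dots> = pi * (1 - s\<^sup>2)"
        using that by (simp add: content_ball unit_ball_vol_2 algebra_simps)
      finally show ?thesis .
    qed
  qed (auto simp: space_restrict_space disk.finite_measure_axioms)
  then show ?thesis by (simp add: field_simps)
qed

interpretation disk: carleson_rotation_invariant lborel_disk pi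
  by unfold_locales (simp add: moment_lborel_disk)

section \<open>Moments of measures with bounded tail quotient\<close>

lemma M_pos_tail:
  assumes "N \<in> M_pos"
  obtains K where "K \<ge> 0" "\<And>r. 0 \<le> r \<Longrightarrow> r < 1 \<Longrightarrow> measure N {r..<1} \<le> K * (1 - r\<^sup>2)"
proof -
  from assms have "bounded (varkappa (of_measure N) ` {0..<1})" unfolding M_pos_def by simp
  then obtain K where "\<forall>y\<in>varkappa (of_measure N) ` {0..<1}. norm y \<le> K"
    unfolding bounded_iff ..
  then have K: "\<And>r. r \<in> {0..<1} \<Longrightarrow> norm (varkappa (of_measure N) r) \<le> K" by blast
  \<comment> \<open>\<open>varkappa\<close> carries a factor 2, hence half of its bound controls the
    tail itself.\<close>
  show ?thesis
  proof (rule that[of "K / 2"])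
    show "0 \<le> K / 2" using order.trans[OF norm_ge_zero K[of 0]] by simp
    show "measure N {r..<1} \<le> K / 2 * (1 - r\<^sup>2)" if "0 \<le> r" "r < 1" for r
    proof -
      have "r\<^sup>2 < 1" using that by (simp add: power_less_one_iff abs_square_less_1)
      then have "norm (varkappa (of_measure N) r) = 2 * measure N {r..<1} / (1 - r\<^sup>2)"
        unfolding varkappa_def of_measure_def norm_divide norm_mult norm_of_real by simp
      with K[of r] that \<open>r\<^sup>2 < 1\<close> show ?thesis by (simp add: field_simps)
    qed
  qed
qed

locale radial_carleson = finite_measure N for N :: "real measure" +
  fixes K :: real
  assumes sets_N: "sets N = sets borel_I"
    and K_nonneg: "K \<ge> 0"
    and tail: "\<And>r. 0 \<le> r \<Longrightarrow> r < 1 \<Longrightarrow> measure N {r..<1} \<le> K * (1 - r\<^sup>2)"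
begin

lemma space_N: "space N = {0..<1}"
  using sets_eq_imp_space_eq[OF sets_N] by (simp add: space_restrict_space)

lemma borel_measurable_N:
  fixes f :: "real \<Rightarrow> 'b::topological_space"
  assumes "f \<in> borel_measurable borel" shows "f \<in> borel_measurable N"
  using measurable_restrict_space1[OF assms, of "{0..<1}"] measurable_cong_sets[OF sets_N refl] by blast

lemma integrable_power: "integrable N (\<lambda>r. r ^ n)"
  using space_N by (intro integrable_const_bound[where B = 1] borel_measurable_N)
    (auto intro!: AE_I2 simp: power_le_one)

lemma integral_power_nonneg: "0 \<le> (\<integral>r. r ^ n \<partial>N)"
  using space_N by (intro integral_nonneg_AE) (auto intro!: AE_I2)

lemma integral_power_le: "(\<integral>r. r ^ (2 * k) \<partial>N) \<le> K / (real k + 1)"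
proof -
  have "(\<integral>r. r ^ (2 * k) \<partial>N) \<le> 2 * K / (real (2 * k) + 2)"
  proof (rule integral_power_le_of_tail)
    fix s :: real assume s: "0 \<le> s" "s < 1"
    then have "{x \<in> space N. s \<le> x} = {s..<1}" using space_N by auto
    then show "measure N {x \<in> space N. s \<le> x} \<le> K * (1 - s\<^sup>2)" using tail[OF s] by simp
  qed (use K_nonneg space_N in \<open>auto intro: borel_measurable_N simp: finite_measure_axioms\<close>)
  then show ?thesis by (simp add: field_simps)
qed

definition gamma :: "nat \<Rightarrow> real" where
  "gamma k = 2 * (real k + 1) * (\<integral>r. r ^ (2 * k) \<partial>N)"

lemma gamma_nonneg: "0 \<le> gamma k"
  unfolding gamma_def using integral_power_nonneg by simp

lemma gamma_le: "gamma k \<le> 2 * K"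
  using integral_power_le[of k] unfolding gamma_def by (simp add: field_simps)

text \<open>
  With \<open>j = k div 2\<close> and \<open>(j + 1) r\<^sup>2\<^sup>j (1 - r\<^sup>2) \<le> 1\<close>, half of the power gives one
  factor \<open>1 / (k + 1)\<close> and the moment of the other half gives the second.
\<close>

lemma integral_power_diff_le:
  "(\<integral>r. r ^ (2 * k) * (1 - r\<^sup>2) \<partial>N) \<le> 4 * K / (real k + 1)\<^sup>2"
proof -
  define j where "j = k div 2"
  have j: "4 * j \<le> 2 * k" "k + 1 \<le> 2 * (j + 1)" unfolding j_def by presburger+
  have pw: "r ^ (2 * k) * (1 - r\<^sup>2) \<le> r ^ (2 * j) / (real j + 1)" if r: "0 \<le> r" "r < 1" for r :: real
  proof -
    \<comment> \<open>Each of the j+1 powers r^(2i) with i \<le> j dominates r^(2j), and multiplying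
      their sum by 1 - r^2 telescopes to 1 - r^(2j+2) \<le> 1.\<close>
    have "(real j + 1) * r ^ (2 * j) = (\<Sum>i<Suc j. r ^ (2 * j))" by simp
    also have "\<dots> \<le> (\<Sum>i<Suc j. (r\<^sup>2) ^ i)"
      using r by (intro sum_mono) (auto simp: power_mult[symmetric] intro!: power_decreasing)
    finally have "(1 - r\<^sup>2) * ((real j + 1) * r ^ (2 * j)) \<le> (1 - r\<^sup>2) * (\<Sum>i<Suc j. (r\<^sup>2) ^ i)"
      using r by (intro mult_left_mono) (auto simp: power_le_one)
    also have "\<dots> = 1 - (r\<^sup>2) ^ Suc j" by (rule one_diff_power_eq[symmetric])
    also have "\<dots> \<le> 1" by simp
    finally have 1: "r ^ (2 * j) * (1 - r\<^sup>2) \<le> 1 / (real j + 1)" by (simp add: field_simps)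
    have "r ^ (2 * k) * (1 - r\<^sup>2) \<le> r ^ (4 * j) * (1 - r\<^sup>2)"
      using r j by (intro mult_right_mono power_decreasing) (auto simp: power_le_one)
    also have "\<dots> = r ^ (2 * j) * (r ^ (2 * j) * (1 - r\<^sup>2))"
      by (simp add: mult.assoc[symmetric] power_add[symmetric])
    also have "\<dots> \<le> r ^ (2 * j) * (1 / (real j + 1))"
      using r 1 by (intro mult_left_mono) auto
    finally show ?thesis by simp
  qed
  have "(\<integral>r. r ^ (2 * k) * (1 - r\<^sup>2) \<partial>N) \<le> (\<integral>r. r ^ (2 * j) / (real j + 1) \<partial>N)"
  proof (rule integral_mono)
    show "integrable N (\<lambda>r. r ^ (2 * k) * (1 - r\<^sup>2))"
    proof -
      have "(\<lambda>r. r ^ (2 * k) * (1 - r\<^sup>2)) = (\<lambda>r::real. r ^ (2 * k) - r ^ (2 * k + 2))"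
        by (simp add: fun_eq_iff power_add power2_eq_square algebra_simps)
      then show ?thesis by (simp only: Bochner_Integration.integrable_diff integrable_power)
    qed
  qed (use integrable_power pw space_N in auto)
  also have "\<dots> = (\<integral>r. r ^ (2 * j) \<partial>N) / (real j + 1)" by simp
  also have "\<dots> \<le> K / (real j + 1) / (real j + 1)"
    by (intro divide_right_mono integral_power_le) simp
  also have "\<dots> = K / (real j + 1)\<^sup>2" by (simp add: power2_eq_square)
  \<comment> \<open>From j+1 \<ge> (k+1)/2; squaring this half produces the factor 4 in the
    statement.\<close>
  also have "\<dots> \<le> K / ((real k + 1) / 2)\<^sup>2"
    using K_nonneg j(2) by (intro divide_left_mono power_mono mult_pos_pos) auto
  also have "\<dots> = 4 * K / (real k + 1)\<^sup>2" by (simp add: power_divide)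
  finally show ?thesis .
qed

text \<open>The increment equals p - q, where p comes from the growth of the prefactor and q from
  the decay of the moment. Both are nonnegative and bounded by the same quantity, so no sum of the
  two bounds is taken. The constant 8 is dictated by q.\<close>

lemma gamma_Suc_diff: "\<bar>gamma (Suc k) - gamma k\<bar> \<le> 8 * K / (real k + 1)"
proof -
  define p where "p = 2 * (\<integral>r. r ^ (2 * Suc k) \<partial>N)"
  define q where "q = 2 * (real k + 1) * (\<integral>r. r ^ (2 * k) * (1 - r\<^sup>2) \<partial>N)"
  have "(\<integral>r. r ^ (2 * k) * (1 - r\<^sup>2) \<partial>N) = (\<integral>r. r ^ (2 * k) - r ^ (2 * Suc k) \<partial>N)"
    by (simp add: power2_eq_square algebra_simps)
  also have "\<dots> = (\<integral>r. r ^ (2 * k) \<partial>N) - (\<integral>r. r ^ (2 * Suc k) \<partial>N)"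
    by (intro Bochner_Integration.integral_diff integrable_power)
  finally have d: "(\<integral>r. r ^ (2 * k) * (1 - r\<^sup>2) \<partial>N) = (\<integral>r. r ^ (2 * k) \<partial>N) - (\<integral>r. r ^ (2 * Suc k) \<partial>N)" .
  define A where "A = (\<integral>r. r ^ (2 * k) \<partial>N)"
  define B where "B = (\<integral>r. r ^ (2 * Suc k) \<partial>N)"
  have "gamma (Suc k) - gamma k = p - q"
    unfolding gamma_def p_def q_def d A_def[symmetric] B_def[symmetric] by (simp add: algebra_simps)
  moreover have "0 \<le> p" unfolding p_def using integral_power_nonneg[of "2 * Suc k"] by linarith
  moreover have "0 \<le> q"
    unfolding q_def using space_N by (intro mult_nonneg_nonneg integral_nonneg_AE AE_I2) (auto simp: power_le_one)
  moreover have "p \<le> 8 * K / (real k + 1)"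
  proof -
    have "p \<le> 2 * (K / (real (Suc k) + 1))" unfolding p_def using integral_power_le[of "Suc k"] by simp
    also have "\<dots> \<le> 8 * (K / (real k + 1))"
      using K_nonneg by (intro mult_mono divide_left_mono) auto
    finally show ?thesis by simp
  qed
  moreover have "q \<le> 8 * K / (real k + 1)"
  proof -
    have "q \<le> 2 * (real k + 1) * (4 * K / (real k + 1)\<^sup>2)"
      unfolding q_def by (intro mult_left_mono integral_power_diff_le) simp
    also have "2 * x * (4 * K / x\<^sup>2) = 8 * K / x" for x :: real by (simp add: power2_eq_square)
    finally show ?thesis .
  qed
  ultimately show ?thesis by linarith
qed

text \<open>The estimate ln x \<le> x - 1 gives ln(k+2) - ln(k+1) \<ge> 1/(k+2) \<ge> 1/(2(k+1)).
  Each increment of \<open>gamma\<close> is thus at most 16K times the matching increment of the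
  logarithm, and these add up along the interval.\<close>

lemma gamma_lipschitz: "\<bar>gamma m - gamma n\<bar> \<le> 16 * K * dlog m n"
proof -
  have inc: "8 * K / (real k + 1) \<le> 16 * K * (ln (real (Suc k) + 1) - ln (real k + 1))" for k
  proof -
    have "1 - (real k + 1) / (real k + 2) \<le> - ln ((real k + 1) / (real k + 2))"
      using ln_le_minus_one[of "(real k + 1) / (real k + 2)"] by simp
    moreover have "1 / (2 * (real k + 1)) \<le> 1 - (real k + 1) / (real k + 2)"
      by (simp add: field_simps)
    ultimately have "1 / (2 * (real k + 1)) \<le> ln (real k + 2) - ln (real k + 1)"
      by (simp add: ln_div)
    then have "16 * K * (1 / (2 * (real k + 1))) \<le> 16 * K * (ln (real k + 2) - ln (real k + 1))"
      using K_nonneg by (intro mult_left_mono) auto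
    moreover have "16 * K * (1 / (2 * (real k + 1))) = 8 * K / (real k + 1)" by (simp add: field_simps)
    ultimately show ?thesis by (simp add: add.commute)
  qed
  have le: "\<bar>gamma m - gamma n\<bar> \<le> 16 * K * (ln (real m + 1) - ln (real n + 1))" if "n \<le> m" for m n
    using that
  proof (induction m rule: dec_induct)
    case (step k)
    then show ?case using gamma_Suc_diff[of k] inc[of k] by (simp add: algebra_simps)
  qed simp
  show ?thesis
  proof (cases "n \<le> m")
    case True
    then show ?thesis using le[OF True] unfolding dlog_def by simp
  next
    case False
    then show ?thesis using le[of m n] unfolding dlog_def by (simp add: abs_minus_commute)
  qed
qed

end

text \<open>Let S be the sum. Since (k+2)^2 - (k+1)^2 = 2(k+1) + 1, the combination S - 1 - xS
  reduces to the geometric series and its derivative, and solving the resulting linear equation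
  gives S.\<close>

lemma sums_Suc_square_power:
  fixes x :: real
  assumes x: "\<bar>x\<bar> < 1"
  shows "(\<lambda>k. (real k + 1)\<^sup>2 * x ^ k) sums ((1 + x) / (1 - x) ^ 3)"
proof -
  have s: "summable (\<lambda>k. (real k + 1)\<^sup>2 * x ^ k)"
  proof -
    obtain y where y: "\<bar>x\<bar> < y" "y < 1" using x dense by blast
    show ?thesis
    proof (cases "x = 0")
      case False
      \<comment> \<open>The growth comparison is made with a positive base t < y; the room between t
        and y absorbs the quadratic factor.\<close>
      define t where "t = \<bar>x\<bar>"
      have t: "0 < t" "t < y" using False y(1) by (auto simp: t_def)
      have "(\<lambda>k. (real k + 1)\<^sup>2 * t ^ k) \<in> O(\<lambda>k. y ^ k)"
        using t y(2) by real_asymp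
      moreover have "(\<lambda>k. (real k + 1)\<^sup>2 * x ^ k) \<in> O(\<lambda>k. (real k + 1)\<^sup>2 * t ^ k)"
        by (intro landau_o.bigI[of 1]) (auto simp: abs_mult power_abs t_def)
      ultimately have "(\<lambda>k. (real k + 1)\<^sup>2 * x ^ k) \<in> O(\<lambda>k. y ^ k)"
        by (rule landau_o.big_trans[rotated])
      moreover have "summable (\<lambda>k. norm (y ^ k))" using t y(2) by (simp add: summable_geometric norm_power)
      ultimately show ?thesis by (rule summable_comparison_test_bigo[rotated])
    qed (simp add: power_0_left if_distrib cong: if_cong)
  qed
  define S where "S = (\<Sum>k. (real k + 1)\<^sup>2 * x ^ k)"
  have S: "(\<lambda>k. (real k + 1)\<^sup>2 * x ^ k) sums S" unfolding S_def using s by (rule summable_sums)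
  have "(\<lambda>k. (real (Suc k) + 1)\<^sup>2 * x ^ Suc k) sums (S - 1)"
    using S by (subst sums_Suc_iff) simp
  moreover have "(\<lambda>k. x * ((real k + 1)\<^sup>2 * x ^ k)) sums (x * S)" by (rule sums_mult[OF S])
  ultimately have "(\<lambda>k. (real (Suc k) + 1)\<^sup>2 * x ^ Suc k - x * ((real k + 1)\<^sup>2 * x ^ k)) sums (S - 1 - x * S)"
    by (rule sums_diff)
  moreover have "(\<lambda>k. x * (2 * (of_nat (Suc k) * x ^ k) + x ^ k)) sums (x * (2 * (1 / (1 - x)\<^sup>2) + 1 / (1 - x)))"
    using x by (intro sums_mult sums_add geometric_deriv_sums geometric_sums) auto
  moreover have "(\<lambda>k. (real (Suc k) + 1)\<^sup>2 * x ^ Suc k - x * ((real k + 1)\<^sup>2 * x ^ k))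
      = (\<lambda>k. x * (2 * (of_nat (Suc k) * x ^ k) + x ^ k))"
    by (simp add: fun_eq_iff power2_eq_square algebra_simps)
  ultimately have Sx: "S - 1 - x * S = x * (2 * (1 / (1 - x)\<^sup>2) + 1 / (1 - x))"
    using sums_unique2 by auto
  define y where "y = 1 - x"
  have y: "y \<noteq> 0" and xy: "x = 1 - y" using x unfolding y_def by auto
  have "S * y = 1 + (S - 1 - x * S)" unfolding y_def by (simp add: algebra_simps)
  then have Sy: "S * y = 1 + (1 - y) * (2 * (1 / y\<^sup>2) + 1 / y)"
    unfolding Sx unfolding xy by simp
  have "S * y ^ 3 = (S * y) * y\<^sup>2" by (simp add: power2_eq_square power3_eq_cube)
  also have "\<dots> = 2 - y" unfolding Sy using y by (simp add: field_simps power2_eq_square)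
  finally have "S * (1 - x) ^ 3 = 1 + x" unfolding y_def by simp
  then have "S = (1 + x) / (1 - x) ^ 3" using y unfolding y_def by (simp add: eq_divide_eq)
  then show ?thesis using S by simp
qed

context radial_carleson
begin

definition beta :: "real \<Rightarrow> real" where
  "beta a = 2 * (1 - a\<^sup>2)\<^sup>2 * (\<integral>r. (1 + a\<^sup>2 * r\<^sup>2) / (1 - a\<^sup>2 * r\<^sup>2) ^ 3 \<partial>N)"

text \<open>The moment bound turns each weight (k+1)^2 into K(k+1), and the sum of K(k+1) a^(2k) is
  K/(1 - a^2)^2. The prefactor of \<open>beta\<close> cancels this denominator exactly, so the bound
  is uniform in \<open>a\<close>.\<close>

lemma
  assumes a: "0 \<le> a" "a < 1"
  shows integrable_beta: "integrable N (\<lambda>r. (1 + a\<^sup>2 * r\<^sup>2) / (1 - a\<^sup>2 * r\<^sup>2) ^ 3)"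
    and beta_bounds: "0 \<le> beta a" "beta a \<le> 2 * K"
proof -
  have a2: "0 \<le> a\<^sup>2" "a\<^sup>2 < 1" using a by (auto simp: abs_square_less_1)
  define g where "g r = (1 + a\<^sup>2 * r\<^sup>2) / (1 - a\<^sup>2 * r\<^sup>2) ^ 3" for r
  have ar: "0 \<le> a\<^sup>2 * r\<^sup>2 \<and> a\<^sup>2 * r\<^sup>2 \<le> a\<^sup>2" if "r \<in> space N" for r
    using that a2 unfolding space_N by (auto intro!: mult_left_le power_le_one)
  have g_nonneg: "0 \<le> g r" if "r \<in> space N" for r
    using ar[OF that] a2 unfolding g_def by auto
  have g_meas: "g \<in> borel_measurable N"
    unfolding g_def by (rule borel_measurable_N) measurable
  have g_le: "g r \<le> 2 / (1 - a\<^sup>2) ^ 3" if "r \<in> space N" for r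
    using ar[OF that] a2 unfolding g_def by (intro frac_le power_mono) auto
  have int: "integrable N g"
    using g_nonneg g_le g_meas by (intro integrable_const_bound[where B = "2 / (1 - a\<^sup>2) ^ 3"]) (auto intro!: AE_I2)
  then show "integrable N (\<lambda>r. (1 + a\<^sup>2 * r\<^sup>2) / (1 - a\<^sup>2 * r\<^sup>2) ^ 3)" unfolding g_def .
  have beta: "beta a = 2 * (1 - a\<^sup>2)\<^sup>2 * integral\<^sup>L N g" unfolding beta_def g_def ..
  show "0 \<le> beta a"
    unfolding beta using g_nonneg by (intro mult_nonneg_nonneg integral_nonneg_AE AE_I2) auto
  have "ennreal (integral\<^sup>L N g) = (\<integral>\<^sup>+r. ennreal (g r) \<partial>N)"
    using int g_nonneg by (intro nn_integral_eq_integral[symmetric] AE_I2) auto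
  also have "\<dots> = (\<integral>\<^sup>+r. (\<Sum>k. ennreal ((real k + 1)\<^sup>2 * (a\<^sup>2) ^ k * r ^ (2 * k))) \<partial>N)"
  proof (rule nn_integral_cong)
    fix r assume r: "r \<in> space N"
    have "(\<lambda>k. (real k + 1)\<^sup>2 * (a\<^sup>2 * r\<^sup>2) ^ k) sums g r"
      unfolding g_def using ar[OF r] a2 by (intro sums_Suc_square_power) auto
    then have "(\<lambda>k. (real k + 1)\<^sup>2 * (a\<^sup>2) ^ k * r ^ (2 * k)) sums g r"
      by (simp add: power_mult_distrib power_mult mult.assoc)
    then show "ennreal (g r) = (\<Sum>k. ennreal ((real k + 1)\<^sup>2 * (a\<^sup>2) ^ k * r ^ (2 * k)))"
      using r unfolding space_N by (subst suminf_ennreal2) (auto simp: sums_iff)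
  qed
  also have "\<dots> = (\<Sum>k. \<integral>\<^sup>+r. ennreal ((real k + 1)\<^sup>2 * (a\<^sup>2) ^ k * r ^ (2 * k)) \<partial>N)"
    by (intro nn_integral_suminf borel_measurable_N) measurable
  also have "\<dots> \<le> (\<Sum>k. ennreal (K * (of_nat (Suc k) * (a\<^sup>2) ^ k)))"
  proof (intro suminf_le summableI)
    fix k
    have "(\<integral>\<^sup>+r. ennreal ((real k + 1)\<^sup>2 * (a\<^sup>2) ^ k * r ^ (2 * k)) \<partial>N)
        = ennreal (\<integral>r. (real k + 1)\<^sup>2 * (a\<^sup>2) ^ k * r ^ (2 * k) \<partial>N)"
      using integrable_power space_N by (intro nn_integral_eq_integral AE_I2) auto
    also have "\<dots> = ennreal ((real k + 1)\<^sup>2 * (a\<^sup>2) ^ k * (\<integral>r. r ^ (2 * k) \<partial>N))" by simp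
    also have "\<dots> \<le> ennreal ((real k + 1)\<^sup>2 * (a\<^sup>2) ^ k * (K / (real k + 1)))"
      by (intro ennreal_leI mult_left_mono integral_power_le) auto
    also have "(real k + 1)\<^sup>2 * (a\<^sup>2) ^ k * (K / (real k + 1)) = K * (of_nat (Suc k) * (a\<^sup>2) ^ k)"
      by (simp add: power2_eq_square field_simps)
    finally show "(\<integral>\<^sup>+r. ennreal ((real k + 1)\<^sup>2 * (a\<^sup>2) ^ k * r ^ (2 * k)) \<partial>N) \<le> ennreal (K * (of_nat (Suc k) * (a\<^sup>2) ^ k))" .
  qed
  also have "\<dots> = ennreal (K * (1 / (1 - a\<^sup>2)\<^sup>2))"
    using sums_mult[OF geometric_deriv_sums[of "a\<^sup>2"], of K] a2 K_nonneg
    by (subst suminf_ennreal2) (auto simp: sums_iff)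
  finally have "integral\<^sup>L N g \<le> K / (1 - a\<^sup>2)\<^sup>2"
    using K_nonneg by (subst (asm) ennreal_le_iff) auto
  then show "beta a \<le> 2 * K"
    unfolding beta using a2 by (simp add: field_simps)
qed

end

section \<open>The measure \<open>\<nu>\<^sub>\<eta>\<close> for positive \<open>\<eta>\<close>\<close>

lemma space_haar_circle: "space haar_circle = \<T>"
  and sets_haar_circle: "sets haar_circle = sets (restrict_space borel \<T>)"
  by (simp_all add: haar_circle_def space_restrict_space)

lemma measurable_cis: "cis \<in> measurable (restrict_space lborel {0..<2*pi}) (restrict_space borel \<T>)"
proof (rule measurable_restrict_space3)
  have "cis \<in> borel_measurable borel"
    by (intro borel_measurable_continuous_onI continuous_intros)
  then show "cis \<in> borel_measurable lborel" by simp
qed auto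

lemma nn_integral_haar_circle:
  assumes "g \<in> borel_measurable (restrict_space borel \<T>)"
  shows "(\<integral>\<^sup>+\<sigma>. g \<sigma> \<partial>haar_circle) = (\<integral>\<^sup>+t. g (cis t) * indicator {0..<2*pi} t \<partial>lborel)"
proof -
  have "(\<integral>\<^sup>+\<sigma>. g \<sigma> \<partial>haar_circle) = (\<integral>\<^sup>+t. g (cis t) \<partial>restrict_space lborel {0..<2*pi})"
    unfolding haar_circle_def using assms by (intro nn_integral_distr measurable_cis) simp
  then show ?thesis by (simp add: nn_integral_restrict_space)
qed

lemma emeasure_haar_circle_space: "emeasure haar_circle \<T> = ennreal (2 * pi)"
proof -
  have "emeasure haar_circle \<T> = (\<integral>\<^sup>+\<sigma>. 1 \<partial>haar_circle)"
    by (simp add: space_haar_circle)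
  also have "\<dots> = ennreal (2 * pi)"
    by (subst nn_integral_haar_circle) auto
  finally show ?thesis .
qed

interpretation haar: finite_measure haar_circle
  by (rule finite_measureI) (simp add: space_haar_circle emeasure_haar_circle_space)

lemma measurable_rotate_circle:
  assumes "norm \<tau> = 1"
  shows "(\<lambda>z. \<tau> * z) \<in> measurable (restrict_space borel \<T>) (restrict_space borel \<T>)"
  by (rule measurable_restrict_space3) (auto simp: norm_mult assms)

text \<open>Rotation by \<open>cis s\<close> translates the angle by s. The part of the shifted
  interval beyond 2\<pi> is brought back to [0,s) by periodicity.\<close>

lemma nn_integral_haar_circle_rotate:
  assumes \<tau>: "norm \<tau> = 1" and g: "g \<in> borel_measurable (restrict_space borel \<T>)"
  shows "(\<integral>\<^sup>+\<sigma>. g (\<tau> * \<sigma>) \<partial>haar_circle) = (\<integral>\<^sup>+\<sigma>. g \<sigma> \<partial>haar_circle)"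
proof -
  obtain s where s: "0 \<le> s" "s < 2 * pi" "\<tau> = cis s"
    using complex_unimodular_polar[OF \<tau>] by (metis cis.code complex_eq Complex_eq)
  define h where "h t = g (cis t)" for t
  have "cis \<in> measurable borel (restrict_space borel \<T>)"
    by (intro measurable_restrict_space2 borel_measurable_continuous_onI continuous_intros) auto
  from measurable_compose[OF this g] have [measurable]: "h \<in> borel_measurable borel"
    unfolding h_def .
  have per: "h (t + 2 * pi) = h t" for t unfolding h_def by (simp add: cis_mult[symmetric])
  have "(\<integral>\<^sup>+\<sigma>. g (\<tau> * \<sigma>) \<partial>haar_circle) = (\<integral>\<^sup>+t. h (t + s) * indicator {0..<2*pi} t \<partial>lborel)"
    using measurable_compose[OF measurable_rotate_circle[OF \<tau>] g]
    by (subst nn_integral_haar_circle) (auto simp: h_def s(3) cis_mult add.commute)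
  also have "\<dots> = (\<integral>\<^sup>+t. h (t + s) * indicator {s..<2*pi+s} (t + s) \<partial>lborel)"
    by (intro nn_integral_cong) (auto simp: indicator_def)
  also have "\<dots> = (\<integral>\<^sup>+t. h t * indicator {s..<2*pi+s} t \<partial>lborel)"
    by (rule nn_integral_lborel_plus) measurable
  also have "\<dots> = (\<integral>\<^sup>+t. h t * indicator {s..<2*pi} t + h t * indicator {2*pi..<2*pi+s} t \<partial>lborel)"
    using s by (intro nn_integral_cong) (auto simp: indicator_def)
  also have "\<dots> = (\<integral>\<^sup>+t. h t * indicator {s..<2*pi} t \<partial>lborel) + (\<integral>\<^sup>+t. h t * indicator {2*pi..<2*pi+s} t \<partial>lborel)"
    by (rule nn_integral_add) measurable
  also have "(\<integral>\<^sup>+t. h t * indicator {2*pi..<2*pi+s} t \<partial>lborel)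
      = (\<integral>\<^sup>+t. h (t + 2*pi) * indicator {2*pi..<2*pi+s} (t + 2*pi) \<partial>lborel)"
    by (rule nn_integral_lborel_plus[symmetric]) measurable
  also have "\<dots> = (\<integral>\<^sup>+t. h t * indicator {0..<s} t \<partial>lborel)"
    unfolding per by (intro nn_integral_cong) (auto simp: indicator_def)
  also have "(\<integral>\<^sup>+t. h t * indicator {s..<2*pi} t \<partial>lborel) + (\<integral>\<^sup>+t. h t * indicator {0..<s} t \<partial>lborel)
      = (\<integral>\<^sup>+t. h t * indicator {s..<2*pi} t + h t * indicator {0..<s} t \<partial>lborel)"
    by (rule nn_integral_add[symmetric]) measurable
  also have "\<dots> = (\<integral>\<^sup>+t. h t * indicator {0..<2*pi} t \<partial>lborel)"
    using s by (intro nn_integral_cong) (auto simp: indicator_def)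
  also have "\<dots> = (\<integral>\<^sup>+\<sigma>. g \<sigma> \<partial>haar_circle)"
    using g by (subst nn_integral_haar_circle) (auto simp: h_def)
  finally show ?thesis .
qed

lemma measurable_polar:
  "(\<lambda>(r, \<tau>). complex_of_real r * \<tau>) \<in> measurable (borel_I \<Otimes>\<^sub>M haar_circle) borel_disk"
proof (rule measurable_restrict_space2)
  show "(\<lambda>(r, \<tau>). complex_of_real r * \<tau>) \<in> space (borel_I \<Otimes>\<^sub>M haar_circle) \<rightarrow> \<D>"
    by (auto simp: space_pair_measure space_restrict_space space_haar_circle norm_mult)
  have 1: "fst \<in> borel_measurable (borel_I \<Otimes>\<^sub>M haar_circle)"
    by (rule measurable_compose[OF measurable_fst measurable_restrict_space1]) simp
  have 2: "snd \<in> borel_measurable (borel_I \<Otimes>\<^sub>M haar_circle)"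
    by (rule measurable_compose[OF measurable_snd[where 'a = real], of "\<lambda>x. x"])
      (simp add: measurable_cong_sets[OF sets_haar_circle refl] measurable_restrict_space1)
  have "(\<lambda>x. complex_of_real (fst x) * snd x) \<in> borel_measurable (borel_I \<Otimes>\<^sub>M haar_circle)"
    using 1 2 by (intro borel_measurable_times measurable_compose[OF 1 borel_measurable_of_real]) auto
  then show "(\<lambda>(r, \<tau>). complex_of_real r * \<tau>) \<in> borel_measurable (borel_I \<Otimes>\<^sub>M haar_circle)"
    by (simp add: case_prod_unfold)
qed

text \<open>A genuine measure built from the ordinary product, so that the usual integration
  theorems apply; \<open>measure_nu_pos\<close> below relates it to the section integrals behind
  \<open>nu_measure\<close>.\<close>

definition nu_pos :: "real measure \<Rightarrow> complex measure" where
  "nu_pos N = distr (N \<Otimes>\<^sub>M haar_circle) borel_disk (\<lambda>(r, \<tau>). complex_of_real r * \<tau>)"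

context radial_carleson
begin

lemma measurable_polar_N: "(\<lambda>(r, \<tau>). complex_of_real r * \<tau>) \<in> measurable (N \<Otimes>\<^sub>M haar_circle) borel_disk"
  using measurable_polar measurable_cong_sets[OF sets_pair_measure_cong[OF sets_N refl] refl] by blast

lemma sets_nu_pos: "sets (nu_pos N) = sets borel_disk"
  unfolding nu_pos_def by simp

lemma nn_integral_nu_pos:
  assumes g: "g \<in> borel_measurable borel_disk"
  shows "(\<integral>\<^sup>+z. g z \<partial>nu_pos N) = (\<integral>\<^sup>+r. \<integral>\<^sup>+\<sigma>. g (of_real r * \<sigma>) \<partial>haar_circle \<partial>N)"
proof -
  have "(\<integral>\<^sup>+z. g z \<partial>nu_pos N) = (\<integral>\<^sup>+x. g (case x of (r, \<sigma>) \<Rightarrow> of_real r * \<sigma>) \<partial>(N \<Otimes>\<^sub>M haar_circle))"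
    unfolding nu_pos_def using g by (intro nn_integral_distr measurable_polar_N) simp
  also have "\<dots> = (\<integral>\<^sup>+r. \<integral>\<^sup>+\<sigma>. g (of_real r * \<sigma>) \<partial>haar_circle \<partial>N)"
    by (subst haar.nn_integral_fst[symmetric]) (use measurable_compose[OF measurable_polar_N g] in auto)
  finally show ?thesis .
qed

lemma emeasure_nu_pos:
  assumes "Z \<in> sets borel_disk"
  shows "emeasure (nu_pos N) Z = (\<integral>\<^sup>+r. \<integral>\<^sup>+\<sigma>. indicator Z (of_real r * \<sigma>) \<partial>haar_circle \<partial>N)"
  using assms nn_integral_nu_pos[of "indicator Z"] by (simp add: sets_nu_pos)

lemma finite_measure_nu_pos: "finite_measure (nu_pos N)"
proof -
  interpret P: finite_measure "N \<Otimes>\<^sub>M haar_circle"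
    by (rule finite_measure_pair_measure) (rule haar.finite_measure_axioms finite_measure_axioms)+
  show ?thesis unfolding nu_pos_def by (rule P.finite_measure_distr[OF measurable_polar_N])
qed

lemma borel_measurable_circle_section:
  assumes g: "g \<in> borel_measurable borel_disk" and r: "r \<in> space N"
  shows "(\<lambda>\<sigma>. g (of_real r * \<sigma>)) \<in> borel_measurable (restrict_space borel \<T>)"
proof (rule measurable_compose[OF _ g])
  show "(\<lambda>\<sigma>. of_real r * \<sigma>) \<in> measurable (restrict_space borel \<T>) borel_disk"
    using r unfolding space_N by (intro measurable_restrict_space3) (auto simp: norm_mult)
qed

text \<open>A rotation of the disk acts on the circle factor alone, so invariance of arc length is
  applied for each fixed radius.\<close>

lemma rotation_invariant_nu_pos: "rotation_invariant (nu_pos N)"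
proof -
  interpret V: finite_measure "nu_pos N" by (rule finite_measure_nu_pos)
  show ?thesis
  proof
    show "sets (nu_pos N) = sets borel_disk" by (rule sets_nu_pos)
    fix \<tau> :: complex assume \<tau>: "norm \<tau> = 1"
    have m: "(\<lambda>z. \<tau> * z) \<in> measurable borel_disk borel_disk"
      by (rule measurable_restrict_space3) (auto simp: norm_mult \<tau>)
    then have m': "(\<lambda>z. \<tau> * z) \<in> measurable (nu_pos N) (nu_pos N)"
      using measurable_cong_sets[OF sets_nu_pos sets_nu_pos] by blast
    show "distr (nu_pos N) (nu_pos N) (\<lambda>z. \<tau> * z) = nu_pos N"
    proof (rule measure_eqI)
      fix Z assume "Z \<in> sets (distr (nu_pos N) (nu_pos N) (\<lambda>z. \<tau> * z))"
      then have Z: "Z \<in> sets borel_disk" by (simp add: sets_nu_pos)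
      have ind: "indicator Z \<in> borel_measurable borel_disk" using Z by simp
      have "emeasure (distr (nu_pos N) (nu_pos N) (\<lambda>z. \<tau> * z)) Z
          = (\<integral>\<^sup>+z. indicator Z z \<partial>distr (nu_pos N) (nu_pos N) (\<lambda>z. \<tau> * z))"
        using Z sets_nu_pos by (subst nn_integral_indicator) auto
      also have "\<dots> = (\<integral>\<^sup>+z. indicator Z (\<tau> * z) \<partial>nu_pos N)"
        using Z sets_nu_pos by (intro nn_integral_distr m') auto
      also have "\<dots> = (\<integral>\<^sup>+r. \<integral>\<^sup>+\<sigma>. indicator Z (\<tau> * (of_real r * \<sigma>)) \<partial>haar_circle \<partial>N)"
        by (rule nn_integral_nu_pos[OF measurable_compose[OF m ind]])
      also have "\<dots> = (\<integral>\<^sup>+r. \<integral>\<^sup>+\<sigma>. indicator Z (of_real r * (\<tau> * \<sigma>)) \<partial>haar_circle \<partial>N)"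
        by (simp add: mult_ac)
      also have "\<dots> = (\<integral>\<^sup>+r. \<integral>\<^sup>+\<sigma>. indicator Z (of_real r * \<sigma>) \<partial>haar_circle \<partial>N)"
        by (intro nn_integral_cong nn_integral_haar_circle_rotate[OF \<tau>] borel_measurable_circle_section ind)
      also have "\<dots> = emeasure (nu_pos N) Z" using Z by (rule emeasure_nu_pos[symmetric])
      finally show "emeasure (distr (nu_pos N) (nu_pos N) (\<lambda>z. \<tau> * z)) Z = emeasure (nu_pos N) Z" .
    qed simp
  qed
qed

sublocale V: rotation_invariant "nu_pos N"
  by (rule rotation_invariant_nu_pos)

lemma moment_nu_pos: "moment (nu_pos N) k = 2 * pi * (\<integral>r. r ^ (2 * k) \<partial>N)"
proof -
  have "ennreal (moment (nu_pos N) k) = (\<integral>\<^sup>+z. ennreal (norm z ^ (2 * k)) \<partial>nu_pos N)"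
    unfolding moment_def using V.integrable_norm_power by (subst nn_integral_eq_integral) auto
  also have "\<dots> = (\<integral>\<^sup>+r. \<integral>\<^sup>+\<sigma>. ennreal (norm (of_real r * \<sigma>) ^ (2 * k)) \<partial>haar_circle \<partial>N)"
    by (intro nn_integral_nu_pos measurable_restrict_space1) measurable
  also have "\<dots> = (\<integral>\<^sup>+r. \<integral>\<^sup>+\<sigma>. ennreal (r ^ (2 * k)) \<partial>haar_circle \<partial>N)"
    by (intro nn_integral_cong) (auto simp: space_haar_circle space_N norm_mult)
  also have "\<dots> = (\<integral>\<^sup>+r. ennreal (2 * pi * r ^ (2 * k)) \<partial>N)"
    proof (rule nn_integral_cong)
    fix r assume "r \<in> space N"
    have "ennreal (r ^ (2 * k)) * ennreal (2 * pi) = ennreal (r ^ (2 * k) * (2 * pi))"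
      by (rule ennreal_mult''[symmetric]) simp
    then show "(\<integral>\<^sup>+\<sigma>. ennreal (r ^ (2 * k)) \<partial>haar_circle) = ennreal (2 * pi * r ^ (2 * k))"
      by (simp add: space_haar_circle emeasure_haar_circle_space mult.commute)
  qed
  also have "\<dots> = ennreal (\<integral>r. 2 * pi * r ^ (2 * k) \<partial>N)"
    using integrable_power by (intro nn_integral_eq_integral) auto
  also have "(\<integral>r. 2 * pi * r ^ (2 * k) \<partial>N) = 2 * pi * (\<integral>r. r ^ (2 * k) \<partial>N)" by simp
  finally show ?thesis
    using V.moment_nonneg integral_power_nonneg by (subst (asm) ennreal_inj) auto
qed

lemma moment_nu_pos_gamma: "moment (nu_pos N) k = pi * gamma k / (real k + 1)"
  unfolding moment_nu_pos gamma_def by (simp add: eq_divide_eq algebra_simps)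

text \<open>The constant is \<pi> times the bound 2K for \<open>gamma\<close>.\<close>

sublocale V: carleson_rotation_invariant "nu_pos N" "2 * pi * K"
proof
  show "moment (nu_pos N) k \<le> 2 * pi * K / (real k + 1)" for k
    using gamma_le[of k] unfolding moment_nu_pos_gamma by (auto intro!: divide_right_mono)
qed

text \<open>\<open>cprod_measure\<close> integrates the circle measure of sections. These are
  bounded by the total arc length, hence integrable against the finite measure \<open>N\<close>, and
  Tonelli identifies the result with the mass under \<open>nu_pos\<close>.\<close>

lemma
  assumes Z: "Z \<in> sets borel_disk"
  defines "E \<equiv> (\<lambda>(r, \<tau>). complex_of_real r * \<tau>) -` Z \<inter> space (borel_I \<Otimes>\<^sub>M haar_circle)"
  shows integrable_section: "integrable N (\<lambda>r. measure haar_circle (Pair r -` E))"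
    and measure_nu_pos: "measure (nu_pos N) Z = (\<integral>r. measure haar_circle (Pair r -` E) \<partial>N)"
proof -
  have sp: "space (borel_I \<Otimes>\<^sub>M haar_circle) = space (N \<Otimes>\<^sub>M haar_circle)"
    by (rule sets_eq_imp_space_eq[OF sets_pair_measure_cong[OF sets_N[symmetric] refl]])
  have E: "E \<in> sets (N \<Otimes>\<^sub>M haar_circle)"
    unfolding E_def sp by (rule measurable_sets[OF measurable_polar_N Z])
  have meas: "(\<lambda>r. measure haar_circle (Pair r -` E)) \<in> borel_measurable N"
    unfolding measure_def using haar.measurable_emeasure_Pair[OF E] by measurable
  show int: "integrable N (\<lambda>r. measure haar_circle (Pair r -` E))"
  proof (rule integrable_const_bound[OF _ meas])
    show "AE r in N. norm (measure haar_circle (Pair r -` E)) \<le> measure haar_circle (space haar_circle)"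
      using haar.bounded_measure by (intro AE_I2) simp
  qed
  have "emeasure (nu_pos N) Z = emeasure (N \<Otimes>\<^sub>M haar_circle) E"
    unfolding nu_pos_def E_def sp by (rule emeasure_distr[OF measurable_polar_N Z])
  also have "\<dots> = (\<integral>\<^sup>+r. emeasure haar_circle (Pair r -` E) \<partial>N)"
    by (rule haar.emeasure_pair_measure_alt[OF E])
  also have "\<dots> = ennreal (\<integral>r. measure haar_circle (Pair r -` E) \<partial>N)"
    unfolding haar.emeasure_eq_measure using int by (intro nn_integral_eq_integral) auto
  finally show "measure (nu_pos N) Z = (\<integral>r. measure haar_circle (Pair r -` E) \<partial>N)"
    unfolding V.emeasure_eq_measure by (subst (asm) ennreal_inj) auto
qed

end

section \<open>Bergman space and Toeplitz operators\<close>

lemma set_integral_disk: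
  fixes f :: "complex \<Rightarrow> 'b::{banach, second_countable_topology}"
  shows "(LINT z:\<D>|lborel. f z) = integral\<^sup>L lborel_disk f"
  unfolding set_lebesgue_integral_def by (subst integral_restrict_space) auto

lemma set_integrable_disk:
  fixes f :: "complex \<Rightarrow> 'b::{banach, second_countable_topology}"
  shows "set_integrable lborel \<D> f \<longleftrightarrow> integrable lborel_disk f"
  unfolding set_integrable_def by (subst integrable_restrict_space) auto

lemma power_series_in_bergman:
  assumes a: "a \<in> bergman_coeffs"
  shows "power_series_on_disk a \<in> bergman"
proof -
  have "power_series_on_disk a holomorphic_on ball 0 1"
  proof (rule power_series_holomorphic)
    fix w :: complex assume w: "w \<in> ball 0 1"
    then have "summable (\<lambda>n. a n * w ^ n)"
      using bergman_coeffs_summable[OF a, of w] summable_norm_cancel by auto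
    then show "(\<lambda>n. a n * (w - 0) ^ n) sums power_series_on_disk a w"
      using w by (simp add: power_series_on_disk_def summable_sums)
  qed
  then show ?thesis
    using disk.integrable_square[OF a] unfolding bergman_def set_integrable_disk
    by (simp add: power_series_on_disk_def)
qed

text \<open>The coefficients are the Taylor coefficients at 0. Parseval in \<open>ennreal\<close>,
  read from the integral to the series, makes their weighted square sum finite; vanishing off the
  disk makes the equality hold everywhere.\<close>

lemma bergman_power_series:
  assumes f: "f \<in> bergman"
  obtains a where "a \<in> bergman_coeffs" "f = power_series_on_disk a"
proof -
  define a where "a n = (deriv ^^ n) f 0 / fact n" for n
  have hol: "f holomorphic_on \<D>" and int: "integrable lborel_disk (\<lambda>z. (norm (f z))\<^sup>2)"
    and off: "\<And>z. z \<notin> \<D> \<Longrightarrow> f z = 0"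
    using f unfolding bergman_def set_integrable_disk by auto
  have sums: "(\<lambda>n. a n * z ^ n) sums f z" if "norm z < 1" for z
    using holomorphic_power_series[OF hol, of z] that by (simp add: a_def)
  have eq: "f = power_series_on_disk a"
    using sums off by (auto simp: fun_eq_iff power_series_on_disk_def sums_iff)
  have conv: "summable (\<lambda>k. norm (a k * z ^ k))" if z: "norm z < 1" for z
  proof -
    \<comment> \<open>Convergence at a point of larger modulus gives absolute convergence at
      z.\<close>
    obtain r where r: "norm z < r" "r < 1" using z dense by blast
    have "summable (\<lambda>k. a k * of_real r ^ k)"
      using sums[of "of_real r"] r norm_ge_zero[of z] by (auto simp: sums_iff abs_of_pos order.strict_trans1)
    then show ?thesis by (rule powser_insidea) (use r in auto)
  qed
  have "(\<Sum>k. ennreal ((norm (a k))\<^sup>2 * moment lborel_disk k)) = (\<integral>\<^sup>+z. ennreal ((norm (f z))\<^sup>2) \<partial>lborel_disk)"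
    unfolding eq using disk.nn_integral_parseval[OF conv] by simp
  also have "\<dots> < \<infinity>" using int by (simp add: integrable_iff_bounded)
  finally have "summable (\<lambda>k. (norm (a k))\<^sup>2 * moment lborel_disk k)"
    using disk.moment_nonneg by (intro summable_suminf_not_top) auto
  then have "summable (\<lambda>k. inverse pi * ((norm (a k))\<^sup>2 * moment lborel_disk k))"
    by (rule summable_mult)
  moreover have "inverse pi * (x * (pi / y)) = x / y" for x y :: real by simp
  ultimately have "a \<in> bergman_coeffs"
    unfolding bergman_coeffs_def moment_lborel_disk by (simp only: mem_Collect_eq)
  then show ?thesis using that eq by blast
qed

lemma bergman_norm_power_series:
  assumes "a \<in> bergman_coeffs"
  shows "bergman_norm (power_series_on_disk a) = sqrt (pi * (\<Sum>k. (norm (a k))\<^sup>2 / (real k + 1)))"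
proof -
  have s: "summable (\<lambda>k. (norm (a k))\<^sup>2 / (real k + 1))" using assms unfolding bergman_coeffs_def by simp
  have "(\<integral>z. (norm (power_series_on_disk a z))\<^sup>2 \<partial>lborel_disk) = (\<Sum>k. (norm (a k))\<^sup>2 * moment lborel_disk k)"
    using disk.parseval[OF assms] by (simp add: sums_iff)
  also have "\<dots> = pi * (\<Sum>k. (norm (a k))\<^sup>2 / (real k + 1))"
    unfolding moment_lborel_disk using s by (subst suminf_mult[symmetric]) (auto simp: mult_ac)
  finally show ?thesis unfolding bergman_norm_def set_integral_disk by simp
qed

lemma bergman_inner_power_series:
  assumes "a \<in> bergman_coeffs" "b \<in> bergman_coeffs"
  shows "(\<lambda>k. a k * cnj (b k) * of_real (pi / (real k + 1))) sums
    bergman_inner (power_series_on_disk a) (power_series_on_disk b)"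
  unfolding bergman_inner_def set_integral_disk moment_lborel_disk[symmetric]
  by (rule disk.parseval_inner[OF assms])

lemma bergman_basis_power_series:
  "(\<lambda>j. if j = k then of_real (sqrt ((real k + 1) / pi)) else 0) \<in> bergman_coeffs"
  "bergman_basis k = power_series_on_disk (\<lambda>j. if j = k then of_real (sqrt ((real k + 1) / pi)) else 0)"
proof -
  let ?c = "complex_of_real (sqrt ((real k + 1) / pi))"
  have "(\<lambda>j. (norm (if j = k then ?c else 0))\<^sup>2 / (real j + 1)) = (\<lambda>j. if j = k then (norm ?c)\<^sup>2 / (real k + 1) else 0)"
    by auto
  then show "(\<lambda>j. if j = k then ?c else 0) \<in> bergman_coeffs"
    unfolding bergman_coeffs_def by (simp only: mem_Collect_eq) (rule sums_summable[OF sums_single])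
  have "(\<lambda>j. (if j = k then ?c else 0) * z ^ j) = (\<lambda>j. if j = k then ?c * z ^ j else 0)" for z
    by auto
  then have "(\<lambda>j. (if j = k then ?c else 0) * z ^ j) sums (?c * z ^ k)" for z
    using sums_single[of k "\<lambda>j. ?c * z ^ j"] by simp
  then show "bergman_basis k = power_series_on_disk (\<lambda>j. if j = k then ?c else 0)"
    unfolding bergman_basis_def power_series_on_disk_def by (auto simp: fun_eq_iff sums_iff)
qed

text \<open>Only the k-th term survives in the inner product; the normalisation sqrt((k+1)/\<pi>)
  times the area moment \<pi>/(k+1) leaves sqrt(\<pi>/(k+1)).\<close>

lemma bergman_R_power_series:
  assumes a: "a \<in> bergman_coeffs"
  shows "bergman_R (power_series_on_disk a) k = a k * of_real (sqrt (pi / (real k + 1)))"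
proof -
  let ?c = "complex_of_real (sqrt ((real k + 1) / pi))"
  have "(\<lambda>j. a j * cnj (if j = k then ?c else 0) * of_real (pi / (real j + 1)))
      = (\<lambda>j. if j = k then a j * ?c * of_real (pi / (real j + 1)) else 0)" by auto
  then have "(a k * ?c * of_real (pi / (real k + 1))) = bergman_R (power_series_on_disk a) k"
    using bergman_inner_power_series[OF a bergman_basis_power_series(1)[of k]]
      sums_single[of k "\<lambda>j. a j * ?c * of_real (pi / (real j + 1))"]
    unfolding bergman_R_def bergman_basis_power_series(2) by (metis (no_types, lifting) sums_unique2)
  moreover have "sqrt ((real k + 1) / pi) * (pi / (real k + 1)) = sqrt (pi / (real k + 1))"
  proof -
    define x where "x = pi / (real k + 1)"
    have x: "x > 0" unfolding x_def by simp
    have "sqrt (1 / x) * x = sqrt x" using x by (simp add: real_sqrt_divide field_simps)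
    then show ?thesis unfolding x_def by simp
  qed
  then have "?c * of_real (pi / (real k + 1)) = of_real (sqrt (pi / (real k + 1)))"
    by (metis of_real_mult)
  ultimately show ?thesis by (metis mult.assoc)
qed

text \<open>The Taylor coefficients of the orthonormal expansion with coordinates \<open>c\<close>
  in \<open>bergman_basis\<close>.\<close>

definition coeffs_of_ell2 :: "(nat \<Rightarrow> complex) \<Rightarrow> nat \<Rightarrow> complex" where
  "coeffs_of_ell2 c k = c k * of_real (sqrt ((real k + 1) / pi))"

lemma coeffs_of_ell2:
  assumes "c \<in> ell2"
  shows "coeffs_of_ell2 c \<in> bergman_coeffs"
proof -
  have "(norm (coeffs_of_ell2 c k))\<^sup>2 / (real k + 1) = (norm (c k))\<^sup>2 / pi" for k
  proof -
    have "(norm (coeffs_of_ell2 c k))\<^sup>2 = (norm (c k))\<^sup>2 * ((real k + 1) / pi)"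
      unfolding coeffs_of_ell2_def by (simp add: norm_mult power_mult_distrib)
    moreover have "x * (y / pi) / y = x / pi" if "y \<noteq> 0" for x y :: real using that by simp
    ultimately show ?thesis by (metis add_nonneg_eq_0_iff of_nat_0_le_iff zero_le_one zero_neq_one)
  qed
  then show ?thesis using assms unfolding bergman_coeffs_def ell2_def by (simp add: summable_divide)
qed

lemma sqrt_cancel: "sqrt ((real k + 1) / pi) * sqrt (pi / (real k + 1)) = 1"
  by (simp flip: real_sqrt_mult)

lemma bergman_R_coeffs_of_ell2:
  assumes "c \<in> ell2"
  shows "bergman_R (power_series_on_disk (coeffs_of_ell2 c)) = c"
proof
  fix k
  have "bergman_R (power_series_on_disk (coeffs_of_ell2 c)) k
      = c k * of_real (sqrt ((real k + 1) / pi) * sqrt (pi / (real k + 1)))"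
    unfolding bergman_R_power_series[OF coeffs_of_ell2[OF assms]] by (simp add: coeffs_of_ell2_def)
  then show "bergman_R (power_series_on_disk (coeffs_of_ell2 c)) k = c k" unfolding sqrt_cancel by simp
qed

lemma bergman_inner_bergman_R:
  assumes a: "a \<in> bergman_coeffs" and b: "b \<in> bergman_coeffs"
  shows "bergman_inner (power_series_on_disk a) (power_series_on_disk b)
    = ell2_inner (bergman_R (power_series_on_disk a)) (bergman_R (power_series_on_disk b))"
proof -
  have "bergman_R (power_series_on_disk a) k * cnj (bergman_R (power_series_on_disk b) k)
      = a k * cnj (b k) * of_real (pi / (real k + 1))" for k
  proof -
    have "sqrt (pi / (real k + 1)) * sqrt (pi / (real k + 1)) = pi / (real k + 1)" by simp
    then show ?thesis
      unfolding bergman_R_power_series[OF a] bergman_R_power_series[OF b]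
      by (simp only: complex_cnj_mult complex_cnj_complex_of_real) (metis (no_types, lifting) mult.assoc mult.left_commute of_real_mult)
  qed
  then show ?thesis
    using bergman_inner_power_series[OF a b] unfolding ell2_inner_def by (simp only: sums_iff)
qed

text \<open>The definite description needs existence and uniqueness. The orthonormal expansion of
  \<open>c\<close> qualifies because R preserves inner products and maps it back to
  \<open>c\<close>; any other candidate is determined by testing against the basis vectors, which R
  sends to unit sequences.\<close>

lemma bergman_R_adj_eq:
  assumes c: "c \<in> ell2"
  shows "bergman_R_adj c = power_series_on_disk (coeffs_of_ell2 c)"
  unfolding bergman_R_adj_def
proof (rule the_equality)
  show "power_series_on_disk (coeffs_of_ell2 c) \<in> bergman \<and>
    (\<forall>f\<in>bergman. bergman_inner f (power_series_on_disk (coeffs_of_ell2 c)) = ell2_inner (bergman_R f) c)"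
    using bergman_inner_bergman_R[OF _ coeffs_of_ell2[OF c]] bergman_R_coeffs_of_ell2[OF c]
      power_series_in_bergman[OF coeffs_of_ell2[OF c]]
    by (metis bergman_power_series)
  fix g assume g: "g \<in> bergman \<and> (\<forall>f\<in>bergman. bergman_inner f g = ell2_inner (bergman_R f) c)"
  then obtain b where b: "b \<in> bergman_coeffs" "g = power_series_on_disk b"
    using bergman_power_series by blast
  have "b k = coeffs_of_ell2 c k" for k
  proof -
    have R: "bergman_R (bergman_basis k) = (\<lambda>j. if j = k then 1 else 0)"
      unfolding bergman_basis_power_series(2)
      by (rule ext, subst bergman_R_power_series[OF bergman_basis_power_series(1)])
        (auto simp: of_real_mult[symmetric] sqrt_cancel simp del: of_real_mult)
    have in_bergman: "bergman_basis k \<in> bergman"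
      unfolding bergman_basis_power_series(2) by (rule power_series_in_bergman[OF bergman_basis_power_series(1)])
    have single: "ell2_inner (bergman_R (bergman_basis k)) d = cnj (d k)" for d
    proof -
      have "(\<lambda>j. (if j = k then 1 else 0) * cnj (d j)) = (\<lambda>j. if j = k then cnj (d j) else 0)" by auto
      then show ?thesis
        unfolding ell2_inner_def R using sums_single[of k "\<lambda>j. cnj (d j)"] by (simp add: sums_iff)
    qed
    have "cnj (c k) = bergman_inner (bergman_basis k) g" using g in_bergman single by metis
    also have "\<dots> = cnj (bergman_R g k)"
      unfolding single[symmetric] unfolding b(2) bergman_basis_power_series(2)
      by (rule bergman_inner_bergman_R[OF bergman_basis_power_series(1) b(1)])
    finally have "c k = b k * of_real (sqrt (pi / (real k + 1)))"
      unfolding b(2) bergman_R_power_series[OF b(1)] by (simp only: complex_cnj_cancel_iff)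
    then have "coeffs_of_ell2 c k = b k * of_real (sqrt (pi / (real k + 1)) * sqrt ((real k + 1) / pi))"
      unfolding coeffs_of_ell2_def by simp
    then show ?thesis using sqrt_cancel[of k] by (simp only: mult.commute[of "sqrt (pi / (real k + 1))"]) simp
  qed
  then show "g = power_series_on_disk (coeffs_of_ell2 c)" unfolding b(2) by (metis ext)
qed

lemma norm_sum_i_power_le:
  assumes "\<And>j. j < 4 \<Longrightarrow> norm (x j) \<le> B"
  shows "norm (\<Sum>j<4. \<i> ^ j * x j) \<le> 4 * B"
proof -
  have "norm (\<Sum>j<4. \<i> ^ j * x j) \<le> (\<Sum>j<4::nat. B)"
    using assms by (intro sum_norm_le) (simp add: norm_mult norm_power)
  then show ?thesis by simp
qed

lemma mult_op_bergman_coeffs: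
  assumes a: "a \<in> bergman_coeffs" and \<alpha>: "\<And>k. norm (\<alpha> k) \<le> B"
  shows "mult_op \<alpha> a \<in> bergman_coeffs"
    and "bergman_norm (power_series_on_disk (mult_op \<alpha> a)) \<le> B * bergman_norm (power_series_on_disk a)"
proof -
  have s: "summable (\<lambda>k. (norm (a k))\<^sup>2 / (real k + 1))" using a unfolding bergman_coeffs_def by simp
  have B: "0 \<le> B" using \<alpha>[of 0] norm_ge_zero order.trans by blast
  have le: "(norm (mult_op \<alpha> a k))\<^sup>2 / (real k + 1) \<le> B\<^sup>2 * ((norm (a k))\<^sup>2 / (real k + 1))" for k
    unfolding mult_op_def norm_mult power_mult_distrib times_divide_eq_right
    using \<alpha> by (intro divide_right_mono mult_right_mono power_mono) auto
  have s': "summable (\<lambda>k. (norm (mult_op \<alpha> a k))\<^sup>2 / (real k + 1))"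
    using le by (intro summable_comparison_test[OF _ summable_mult[OF s, of "B\<^sup>2"]]) auto
  then show m: "mult_op \<alpha> a \<in> bergman_coeffs" unfolding bergman_coeffs_def by simp
  have "(\<Sum>k. (norm (mult_op \<alpha> a k))\<^sup>2 / (real k + 1)) \<le> (\<Sum>k. B\<^sup>2 * ((norm (a k))\<^sup>2 / (real k + 1)))"
    by (intro suminf_le le s' summable_mult s)
  also have "\<dots> = B\<^sup>2 * (\<Sum>k. (norm (a k))\<^sup>2 / (real k + 1))" by (rule suminf_mult[OF s])
  finally have "pi * (\<Sum>k. (norm (mult_op \<alpha> a k))\<^sup>2 / (real k + 1)) \<le> B\<^sup>2 * (pi * (\<Sum>k. (norm (a k))\<^sup>2 / (real k + 1)))"
    by (simp add: mult.left_commute)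
  then have "sqrt (pi * (\<Sum>k. (norm (mult_op \<alpha> a k))\<^sup>2 / (real k + 1))) \<le> sqrt (B\<^sup>2 * (pi * (\<Sum>k. (norm (a k))\<^sup>2 / (real k + 1))))"
    by (rule real_sqrt_le_mono)
  also have "\<dots> = B * sqrt (pi * (\<Sum>k. (norm (a k))\<^sup>2 / (real k + 1)))"
    using B by (simp add: real_sqrt_mult)
  finally show "bergman_norm (power_series_on_disk (mult_op \<alpha> a)) \<le> B * bergman_norm (power_series_on_disk a)"
    unfolding bergman_norm_power_series[OF m] bergman_norm_power_series[OF a] .
qed

text \<open>The weighted squares are (k+1)|z|^(2k), a convergent series because |z| < 1, and the
  closed form is the derivative of the geometric series. The conjugate appears because the inner
  product conjugates its second argument.\<close>

lemma bergman_kernel: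
  assumes z: "norm z < 1"
  defines "b \<equiv> \<lambda>k. (of_nat k + 1) * cnj z ^ k"
  shows "b \<in> bergman_coeffs"
    and "w \<in> \<D> \<Longrightarrow> cnj (power_series_on_disk b w) = 1 / (1 - z * cnj w)\<^sup>2"
proof -
  have "norm ((norm z)\<^sup>2) < 1" using z by (simp add: abs_square_less_1)
  from geometric_deriv_sums[OF this] have "summable (\<lambda>k. of_nat (Suc k) * ((norm z)\<^sup>2) ^ k)"
    by (simp only: sums_iff)
  moreover have "(norm (b k))\<^sup>2 / (real k + 1) = of_nat (Suc k) * ((norm z)\<^sup>2) ^ k" for k
  proof -
    have "norm (of_nat k + 1 :: complex) = real k + 1"
      by (metis norm_of_nat of_nat_Suc add.commute)
    then show ?thesis
      unfolding b_def norm_mult norm_power complex_mod_cnj power_mult_distrib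
      by (simp add: power2_eq_square power_mult_distrib)
  qed
  ultimately show "b \<in> bergman_coeffs" unfolding bergman_coeffs_def by simp
  assume w: "w \<in> \<D>"
  then have "norm (cnj z * w) < 1"
    using z mult_strict_mono'[of "norm z" 1 "norm w" 1] by (simp add: norm_mult)
  from geometric_deriv_sums[OF this] have "power_series_on_disk b w = 1 / (1 - cnj z * w)\<^sup>2"
    using w unfolding power_series_on_disk_def b_def
    by (simp add: sums_iff power_mult_distrib mult_ac add.commute)
  then show "cnj (power_series_on_disk b w) = 1 / (1 - z * cnj w)\<^sup>2" by simp
qed

section \<open>Toeplitz operators of complex measures, recombined from four positive parts\<close>

locale radial_four_part =
  fixes \<eta> :: "real set \<Rightarrow> complex" and N :: "nat \<Rightarrow> real measure" and K :: real
  assumes four_part_\<eta>: "four_part borel_I \<eta> N"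
    and radial: "\<And>j. j < 4 \<Longrightarrow> radial_carleson (N j) K"
begin

lemma K_nonneg: "0 \<le> K"
  using radial_carleson.K_nonneg[OF radial[of 0]] by simp

text \<open>The section integrals are evaluated along the given parts of \<eta>. This makes
  \<open>nu_measure\<close> itself a four-part combination, so integrals against it also split into
  integrals against the \<open>nu_pos (N j)\<close>.\<close>

lemma nu_measure_eq:
  assumes Z: "Z \<in> sets borel_disk"
  shows "nu_measure \<eta> Z = (\<Sum>j<4. \<i> ^ j * of_real (measure (nu_pos (N j)) Z))"
proof -
  let ?E = "(\<lambda>(r, \<tau>). complex_of_real r * \<tau>) -` Z \<inter> space (borel_I \<Otimes>\<^sub>M haar_circle)"
  have "nu_measure \<eta> Z = cintegral borel_I \<eta> (\<lambda>r. complex_of_real (measure haar_circle (Pair r -` ?E)))"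
    unfolding nu_measure_def cdistr_def cprod_measure_def ..
  also have "\<dots> = (\<Sum>j<4. \<i> ^ j * (\<integral>r. complex_of_real (measure haar_circle (Pair r -` ?E)) \<partial>N j))"
    by (rule cintegral_four_part[OF four_part_\<eta>])
      (intro integrable_of_real radial_carleson.integrable_section[OF radial Z])
  also have "\<dots> = (\<Sum>j<4. \<i> ^ j * of_real (measure (nu_pos (N j)) Z))"
    by (intro sum.cong refl) (simp only: integral_complex_of_real radial_carleson.measure_nu_pos[OF radial Z] lessThan_iff)
  finally show ?thesis .
qed

lemma four_part_nu: "four_part borel_disk (nu_measure \<eta>) (\<lambda>j. nu_pos (N j))"
  unfolding four_part_def
  using nu_measure_eq radial_carleson.finite_measure_nu_pos[OF radial] radial_carleson.sets_nu_pos[OF radial]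
  by blast

lemma radial_nu: "radial_measure (nu_measure \<eta>)"
  unfolding radial_measure_def
proof (intro conjI ballI)
  show "complex_measure borel_disk (nu_measure \<eta>)"
    by (rule complex_measure_four_part[OF four_part_nu])
  fix \<tau> :: complex and Z assume \<tau>: "\<tau> \<in> \<T>" and Z: "Z \<in> sets borel_disk"
  have \<tau>1: "norm (inverse \<tau>) = 1" and \<tau>0: "\<tau> \<noteq> 0" using \<tau> by (auto simp: norm_inverse)
  have ZD: "Z \<subseteq> \<D>" using sets.sets_into_space[OF Z] by (simp add: space_restrict_space)
  \<comment> \<open>Pushforward invariance concerns preimages, so the rotated set is rewritten as a
    preimage under the inverse rotation; this also gives its measurability.\<close>
  have img: "(\<lambda>z. \<tau> * z) ` Z = (\<lambda>z. inverse \<tau> * z) -` Z \<inter> \<D>"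
  proof
    show "(\<lambda>z. \<tau> * z) ` Z \<subseteq> (\<lambda>z. inverse \<tau> * z) -` Z \<inter> \<D>"
      using ZD \<tau> \<tau>0 by (auto simp: norm_mult mult.assoc[symmetric])
    show "(\<lambda>z. inverse \<tau> * z) -` Z \<inter> \<D> \<subseteq> (\<lambda>z. \<tau> * z) ` Z"
    proof
      fix w assume "w \<in> (\<lambda>z. inverse \<tau> * z) -` Z \<inter> \<D>"
      then have "inverse \<tau> * w \<in> Z" "w = \<tau> * (inverse \<tau> * w)" using \<tau>0 by auto
      then show "w \<in> (\<lambda>z. \<tau> * z) ` Z" by blast
    qed
  qed
  have meas: "measure (nu_pos (N j)) ((\<lambda>z. \<tau> * z) ` Z) = measure (nu_pos (N j)) Z"
    and sets: "(\<lambda>z. \<tau> * z) ` Z \<in> sets borel_disk" if j: "j < 4" for j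
  proof -
    interpret radial_carleson "N j" K by (rule radial[OF j])
    note m = V.measurable_rotate[OF \<tau>1]
    have Z': "Z \<in> sets (nu_pos (N j))" using Z sets_nu_pos by simp
    have "measure (nu_pos (N j)) Z = measure (distr (nu_pos (N j)) (nu_pos (N j)) (\<lambda>z. inverse \<tau> * z)) Z"
      unfolding V.distr_rotate[OF \<tau>1] ..
    also have "\<dots> = measure (nu_pos (N j)) ((\<lambda>z. \<tau> * z) ` Z)"
      unfolding img using measure_distr[OF m Z'] by (simp add: V.space_V)
    finally show "measure (nu_pos (N j)) ((\<lambda>z. \<tau> * z) ` Z) = measure (nu_pos (N j)) Z" by simp
    show "(\<lambda>z. \<tau> * z) ` Z \<in> sets borel_disk"
      unfolding img using measurable_sets[OF m Z'] unfolding V.space_V sets_nu_pos .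
  qed
  show "nu_measure \<eta> ((\<lambda>z. \<tau> * z) ` Z) = nu_measure \<eta> Z"
    unfolding nu_measure_eq[OF sets[of 0, simplified]] nu_measure_eq[OF Z] using meas by simp
qed

lemma gamma_seq_eq: "gamma_seq \<eta> k = (\<Sum>j<4. \<i> ^ j * of_real (radial_carleson.gamma (N j) k))"
proof -
  have "cintegral borel_I \<eta> (\<lambda>r. complex_of_real (r ^ (2 * k)))
      = (\<Sum>j<4. \<i> ^ j * (\<integral>r. complex_of_real (r ^ (2 * k)) \<partial>N j))"
    by (rule cintegral_four_part[OF four_part_\<eta>])
      (intro integrable_of_real radial_carleson.integrable_power[OF radial])
  also have "\<dots> = (\<Sum>j<4. \<i> ^ j * of_real (\<integral>r. r ^ (2 * k) \<partial>N j))"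
    by (simp only: integral_complex_of_real)
  finally show ?thesis
    unfolding gamma_seq_def
    by (simp add: sum_distrib_left radial_carleson.gamma_def[OF radial] mult_ac)
qed

lemma beta_fun_eq:
  assumes "0 \<le> a" "a < 1"
  shows "beta_fun \<eta> a = (\<Sum>j<4. \<i> ^ j * of_real (radial_carleson.beta (N j) a))"
proof -
  let ?g = "\<lambda>r. (1 + a\<^sup>2 * r\<^sup>2) / (1 - a\<^sup>2 * r\<^sup>2) ^ 3"
  have "cintegral borel_I \<eta> (\<lambda>r. complex_of_real (?g r)) = (\<Sum>j<4. \<i> ^ j * (\<integral>r. complex_of_real (?g r) \<partial>N j))"
    by (rule cintegral_four_part[OF four_part_\<eta>])
      (intro integrable_of_real radial_carleson.integrable_beta[OF radial assms])
  also have "\<dots> = (\<Sum>j<4. \<i> ^ j * of_real (\<integral>r. ?g r \<partial>N j))"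
    by (simp only: integral_complex_of_real)
  finally have "beta_fun \<eta> a = of_real (2 * (1 - a\<^sup>2)\<^sup>2) * (\<Sum>j<4. \<i> ^ j * of_real (\<integral>r. ?g r \<partial>N j))"
    unfolding beta_fun_def by simp
  also have "\<dots> = (\<Sum>j<4. \<i> ^ j * of_real (2 * (1 - a\<^sup>2)\<^sup>2 * (\<integral>r. ?g r \<partial>N j)))"
    unfolding sum_distrib_left of_real_mult by (simp only: mult_ac)
  also have "\<dots> = (\<Sum>j<4. \<i> ^ j * of_real (radial_carleson.beta (N j) a))"
    by (intro sum.cong refl) (simp only: radial_carleson.beta_def[OF radial] lessThan_iff)
  finally show ?thesis .
qed

lemma norm_gamma_seq_le: "norm (gamma_seq \<eta> k) \<le> 8 * K"
proof -
  have "norm (gamma_seq \<eta> k) \<le> 4 * (2 * K)"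
    unfolding gamma_seq_eq
    using radial_carleson.gamma_le[OF radial] radial_carleson.gamma_nonneg[OF radial]
    by (intro norm_sum_i_power_le) simp
  then show ?thesis by simp
qed

lemma norm_beta_fun_le:
  assumes "0 \<le> a" "a < 1"
  shows "norm (beta_fun \<eta> a) \<le> 4 * (2 * K)"
  unfolding beta_fun_eq[OF assms]
  using radial_carleson.beta_bounds[OF radial assms]
  by (intro norm_sum_i_power_le) simp

lemma norm_varkappa_le:
  assumes r: "0 \<le> r" "r < 1"
  shows "norm (varkappa \<eta> r) \<le> 4 * (2 * K)"
proof -
  have r2: "r\<^sup>2 < 1" using r by (simp add: abs_square_less_1)
  have "{r..<1} \<in> sets borel_I" using r by (auto simp: sets_restrict_space_iff)
  then have "\<eta> {r..<1} = (\<Sum>j<4. \<i> ^ j * of_real (measure (N j) {r..<1}))"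
    using four_part_\<eta> unfolding four_part_def by blast
  then have "varkappa \<eta> r = (\<Sum>j<4. \<i> ^ j * of_real (2 * measure (N j) {r..<1} / (1 - r\<^sup>2)))"
    unfolding varkappa_def by (simp add: sum_distrib_left sum_divide_distrib mult_ac)
  also have "norm \<dots> \<le> 4 * (2 * K)"
  proof (rule norm_sum_i_power_le)
    fix j :: nat assume j: "j < 4"
    have "2 * measure (N j) {r..<1} / (1 - r\<^sup>2) \<le> 2 * K"
      using radial_carleson.tail[OF radial[OF j] r] r2 by (simp add: field_simps)
    then show "norm (complex_of_real (2 * measure (N j) {r..<1} / (1 - r\<^sup>2))) \<le> 2 * K"
      using r2 unfolding norm_of_real by (subst abs_of_nonneg) auto
  qed
  finally show ?thesis .
qed

lemma gamma_seq_lipschitz: "lipschitz_dlog (gamma_seq \<eta>)"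
  unfolding lipschitz_dlog_def
proof (intro exI conjI allI)
  show "0 \<le> 64 * K" using K_nonneg by simp
  fix m n
  have "gamma_seq \<eta> m - gamma_seq \<eta> n
      = (\<Sum>j<4. \<i> ^ j * of_real (radial_carleson.gamma (N j) m - radial_carleson.gamma (N j) n))"
    unfolding gamma_seq_eq sum_subtractf[symmetric] by (simp add: right_diff_distrib)
  also have "norm \<dots> \<le> 4 * (16 * K * dlog m n)"
    using radial_carleson.gamma_lipschitz[OF radial]
    by (intro norm_sum_i_power_le) (simp only: norm_of_real)
  finally show "dist (gamma_seq \<eta> m) (gamma_seq \<eta> n) \<le> 64 * K * dlog m n"
    by (simp add: dist_norm)
qed

text \<open>The integrand is one power series times the conjugate of another, and both coefficient
  sequences lie in \<open>bergman_coeffs\<close>, so convergence and value come together from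
  \<open>integrable_inner\<close> and \<open>parseval_inner\<close>. The four resulting series are
  added termwise to reassemble \<open>gamma_seq\<close>.\<close>

lemma
  assumes a: "a \<in> bergman_coeffs" and z: "z \<in> \<D>"
  shows cintegrable_toeplitz: "cintegrable borel_disk (nu_measure \<eta>)
      (\<lambda>w. power_series_on_disk a w / (1 - z * cnj w)\<^sup>2)"
    and toeplitz_power_series_at: "toeplitz (nu_measure \<eta>) (power_series_on_disk a) z
      = power_series_on_disk (mult_op (gamma_seq \<eta>) a) z"
proof -
  have z1: "norm z < 1" using z by simp
  define b where "b k = (of_nat k + 1) * cnj z ^ k" for k :: nat
  note kernel = bergman_kernel[OF z1, folded b_def]
  define F where "F w = power_series_on_disk a w / (1 - z * cnj w)\<^sup>2" for w
  have F: "F w = power_series_on_disk a w * cnj (power_series_on_disk b w)" if "w \<in> \<D>" for w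
    unfolding F_def kernel(2)[OF that] by simp
  have part: "integrable (nu_pos (N j)) F"
    "(\<lambda>k. of_real pi * (of_real (radial_carleson.gamma (N j) k) * a k * z ^ k)) sums integral\<^sup>L (nu_pos (N j)) F"
    if j: "j < 4" for j
  proof -
    interpret radial_carleson "N j" K by (rule radial[OF j])
    show "integrable (nu_pos (N j)) F"
      using V.integrable_inner[OF a kernel(1)] F V.space_V
      by (subst Bochner_Integration.integrable_cong[OF refl, where g = "\<lambda>w. power_series_on_disk a w * cnj (power_series_on_disk b w)"]) auto
    have "integral\<^sup>L (nu_pos (N j)) F = (\<integral>w. power_series_on_disk a w * cnj (power_series_on_disk b w) \<partial>nu_pos (N j))"
      using F V.space_V by (intro Bochner_Integration.integral_cong) auto
    \<comment> \<open>The factor k+1 of the kernel coefficient cancels the denominator of the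
      moment; the remaining \<pi> is removed later by the prefactor of
      \<open>toeplitz\<close>.\<close>
    moreover have "a k * cnj (b k) * of_real (moment (nu_pos (N j)) k) = of_real pi * (of_real (gamma k) * a k * z ^ k)" for k
    proof -
      have "of_nat k + 1 \<noteq> (0::complex)" by (metis of_nat_Suc add.commute of_nat_neq_0)
      then show ?thesis unfolding moment_nu_pos_gamma b_def by (simp add: field_simps)
    qed
    ultimately show "(\<lambda>k. of_real pi * (of_real (gamma k) * a k * z ^ k)) sums integral\<^sup>L (nu_pos (N j)) F"
      using V.parseval_inner[OF a kernel(1)] by (simp only:)
  qed
  show "cintegrable borel_disk (nu_measure \<eta>) (\<lambda>w. power_series_on_disk a w / (1 - z * cnj w)\<^sup>2)"
    using cintegrable_four_part[OF four_part_nu part(1)] unfolding F_def by blast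
  have "toeplitz (nu_measure \<eta>) (power_series_on_disk a) z
      = 1 / of_real pi * cintegral borel_disk (nu_measure \<eta>) F"
    unfolding toeplitz_def F_def using z by simp
  also have "cintegral borel_disk (nu_measure \<eta>) F = (\<Sum>j<4. \<i> ^ j * integral\<^sup>L (nu_pos (N j)) F)"
    by (rule cintegral_four_part[OF four_part_nu part(1)])
  finally have T: "toeplitz (nu_measure \<eta>) (power_series_on_disk a) z
      = 1 / of_real pi * (\<Sum>j<4. \<i> ^ j * integral\<^sup>L (nu_pos (N j)) F)" .
  have "(\<lambda>k. 1 / of_real pi * (\<Sum>j<4. \<i> ^ j * (of_real pi * (of_real (radial_carleson.gamma (N j) k) * a k * z ^ k))))
      sums toeplitz (nu_measure \<eta>) (power_series_on_disk a) z"
    unfolding T by (intro sums_mult sums_sum part(2)) simp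
  also have "(\<lambda>k. 1 / of_real pi * (\<Sum>j<4. \<i> ^ j * (of_real pi * (of_real (radial_carleson.gamma (N j) k) * a k * z ^ k))))
      = (\<lambda>k. mult_op (gamma_seq \<eta>) a k * z ^ k)"
    unfolding mult_op_def gamma_seq_eq by (simp add: sum_distrib_left sum_distrib_right mult_ac)
  finally show "toeplitz (nu_measure \<eta>) (power_series_on_disk a) z
      = power_series_on_disk (mult_op (gamma_seq \<eta>) a) z"
    unfolding power_series_on_disk_def using z by (simp add: sums_iff)
qed

lemma toeplitz_power_series:
  assumes "a \<in> bergman_coeffs"
  shows "toeplitz (nu_measure \<eta>) (power_series_on_disk a) = power_series_on_disk (mult_op (gamma_seq \<eta>) a)"
proof
  fix z
  show "toeplitz (nu_measure \<eta>) (power_series_on_disk a) z = power_series_on_disk (mult_op (gamma_seq \<eta>) a) z"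
    using toeplitz_power_series_at[OF assms, of z]
    by (cases "z \<in> \<D>") (auto simp: toeplitz_def power_series_on_disk_def)
qed

lemma toeplitz_defined_nu: "toeplitz_defined (nu_measure \<eta>)"
  unfolding toeplitz_defined_def by (metis bergman_power_series cintegrable_toeplitz)

text \<open>On coefficients the operator multiplies by \<open>gamma_seq\<close> and a rotation by
  powers of 1/\<tau>. Both actions are diagonal and therefore commute; the norm bound is the
  supremum bound 8K.\<close>

lemma bounded_radial_toeplitz: "bounded_radial_operator (toeplitz (nu_measure \<eta>))"
proof -
  let ?T = "toeplitz (nu_measure \<eta>)" and ?M = "mult_op (gamma_seq \<eta>)"
  note M = mult_op_bergman_coeffs[where \<alpha> = "gamma_seq \<eta>", OF _ norm_gamma_seq_le]
  have lin: "?T (\<lambda>z. f z + c * g z) = (\<lambda>z. ?T f z + c * ?T g z)" if "f \<in> bergman" "g \<in> bergman" for f g c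
  proof -
    from that obtain a b where a: "a \<in> bergman_coeffs" "f = power_series_on_disk a"
      and b: "b \<in> bergman_coeffs" "g = power_series_on_disk b"
      by (metis bergman_power_series)
    have "?T (\<lambda>z. f z + c * g z) = ?T (power_series_on_disk (\<lambda>k. a k + c * b k))"
      unfolding a(2) b(2) power_series_on_disk_add[OF a(1) b(1)] ..
    also have "\<dots> = power_series_on_disk (?M (\<lambda>k. a k + c * b k))"
      by (rule toeplitz_power_series[OF bergman_coeffs_add[OF a(1) b(1)]])
    also have "?M (\<lambda>k. a k + c * b k) = (\<lambda>k. ?M a k + c * ?M b k)"
      by (simp add: mult_op_def fun_eq_iff algebra_simps)
    also have "power_series_on_disk \<dots> = (\<lambda>z. ?T f z + c * ?T g z)"
      unfolding a(2) b(2) toeplitz_power_series[OF a(1)] toeplitz_power_series[OF b(1)]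
      by (rule ext) (rule power_series_on_disk_add[OF M(1)[OF a(1)] M(1)[OF b(1)]])
    finally show ?thesis .
  qed
  have zero: "(\<lambda>z. 0) \<in> bergman"
    unfolding bergman_def set_integrable_disk by simp
  \<comment> \<open>With both functions zero and c = -1, \<open>lin\<close> reads T0 = T0 - T0.
    Scaling then follows from \<open>lin\<close> with zero as the first function.\<close>
  have "?T (\<lambda>z. 0) = (\<lambda>z. 0)" using lin[OF zero zero, of "-1"] by (simp add: fun_eq_iff)
  then have scale: "?T (\<lambda>z. c * f z) = (\<lambda>z. c * ?T f z)" if "f \<in> bergman" for f c
    using lin[OF zero that, of c] by simp
  have bounded: "bounded_operator ?T"
    unfolding bounded_operator_def
  proof (intro conjI ballI allI exI)
    fix f assume f: "f \<in> bergman"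
    then obtain a where a: "a \<in> bergman_coeffs" "f = power_series_on_disk a" by (rule bergman_power_series)
    show "?T f \<in> bergman"
      unfolding a(2) toeplitz_power_series[OF a(1)] by (rule power_series_in_bergman[OF M(1)[OF a(1)]])
    show "bergman_norm (?T f) \<le> 8 * K * bergman_norm f"
      unfolding a(2) toeplitz_power_series[OF a(1)] by (rule M(2)[OF a(1)])
    show "?T (\<lambda>z. f z + g z) = (\<lambda>z. ?T f z + ?T g z)" if "g \<in> bergman" for g
      using lin[OF f that, of 1] by simp
  qed (rule scale)
  have "?T (rotation \<tau> f) = rotation \<tau> (?T f)" if \<tau>: "\<tau> \<in> \<T>" and f: "f \<in> bergman" for \<tau> f
  proof -
    from f obtain a where a: "a \<in> bergman_coeffs" "f = power_series_on_disk a" by (rule bergman_power_series)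
    have rot: "rotation \<tau> (power_series_on_disk b) = power_series_on_disk (\<lambda>k. b k * inverse \<tau> ^ k)" for b
      using \<tau> by (simp add: rotation_def power_series_on_disk_def fun_eq_iff norm_mult norm_inverse power_mult_distrib mult.assoc)
    have "(\<lambda>k. a k * inverse \<tau> ^ k) \<in> bergman_coeffs"
      using a(1) \<tau> unfolding bergman_coeffs_def by (simp add: norm_mult norm_power norm_inverse)
    then have "?T (rotation \<tau> f) = power_series_on_disk (?M (\<lambda>k. a k * inverse \<tau> ^ k))"
      unfolding a(2) rot by (rule toeplitz_power_series)
    also have "?M (\<lambda>k. a k * inverse \<tau> ^ k) = (\<lambda>k. ?M a k * inverse \<tau> ^ k)"
      by (simp add: mult_op_def fun_eq_iff)
    finally show ?thesis unfolding a(2) toeplitz_power_series[OF a(1)] rot .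
  qed
  with bounded show ?thesis unfolding bounded_radial_operator_def by blast
qed

lemma bergman_R_toeplitz:
  assumes c: "c \<in> ell2"
  shows "bergman_R (toeplitz (nu_measure \<eta>) (bergman_R_adj c)) = mult_op (gamma_seq \<eta>) c"
proof
  fix k
  note a = coeffs_of_ell2[OF c]
  have "bergman_R (toeplitz (nu_measure \<eta>) (bergman_R_adj c)) k
      = gamma_seq \<eta> k * bergman_R (power_series_on_disk (coeffs_of_ell2 c)) k"
    unfolding bergman_R_adj_eq[OF c] toeplitz_power_series[OF a] bergman_R_power_series[OF a]
      bergman_R_power_series[OF mult_op_bergman_coeffs(1)[where \<alpha> = "gamma_seq \<eta>", OF a norm_gamma_seq_le]]
    by (simp add: mult_op_def)
  then show "bergman_R (toeplitz (nu_measure \<eta>) (bergman_R_adj c)) k = mult_op (gamma_seq \<eta>) c k"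
    unfolding bergman_R_coeffs_of_ell2[OF c] mult_op_def .
qed

end

lemma M_complex_radial_four_part:
  assumes "\<eta> \<in> M_complex"
  obtains N K where "radial_four_part \<eta> N K"
proof -
  from assms obtain N1 N2 N3 N4 where N: "N1 \<in> M_pos" "N2 \<in> M_pos" "N3 \<in> M_pos" "N4 \<in> M_pos"
    and \<eta>: "\<forall>A\<in>sets borel_I. \<eta> A = of_measure N1 A - of_measure N2 A + \<i> * (of_measure N3 A - of_measure N4 A)"
    unfolding M_complex_def by blast
  \<comment> \<open>The parts are listed in this order so that the weights 1, i, -1, -i reproduce
    the signs of the decomposition.\<close>
  define M where "M j = [N1, N3, N2, N4] ! j" for j :: nat
  have M: "M j \<in> M_pos" if "j < 4" for j
    using that N unfolding M_def by (auto simp: less_Suc_eq numeral_nat)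
  then have "\<forall>j\<in>{..<4}. \<exists>K\<ge>0. \<forall>r. 0 \<le> r \<longrightarrow> r < 1 \<longrightarrow> measure (M j) {r..<1} \<le> K * (1 - r\<^sup>2)"
    by (metis M_pos_tail lessThan_iff)
  then obtain L where L: "\<And>j. j < 4 \<Longrightarrow> 0 \<le> L j"
    "\<And>j r. j < 4 \<Longrightarrow> 0 \<le> r \<Longrightarrow> r < 1 \<Longrightarrow> measure (M j) {r..<1} \<le> L j * (1 - r\<^sup>2)"
    unfolding bchoice_iff by (metis lessThan_iff)
  \<comment> \<open>The four tail constants are nonnegative, so their sum dominates each of them and
    serves as a common constant.\<close>
  define K where "K = (\<Sum>j<4. L j)"
  have fin: "finite_measure (M j)" "sets (M j) = sets borel_I" if "j < 4" for j
    using M[OF that] unfolding M_pos_def by auto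
  have "radial_four_part \<eta> M K"
  proof (rule radial_four_part.intro)
    show "four_part borel_I \<eta> M"
      unfolding four_part_def
    proof (intro conjI allI impI ballI fin)
      fix A assume "A \<in> sets borel_I"
      then show "\<eta> A = (\<Sum>j<4. \<i> ^ j * of_real (measure (M j) A))"
        using \<eta> by (simp add: sum_lessThan_4 M_def of_measure_def power3_eq_cube numeral_nat algebra_simps)
    qed
    fix j :: nat assume j: "j < 4"
    have LK: "L j \<le> K" unfolding K_def using j L(1) by (intro member_le_sum) auto
    show "radial_carleson (M j) K"
    proof (intro radial_carleson.intro radial_carleson_axioms.intro fin[OF j])
      show "0 \<le> K" using LK L(1)[OF j] by simp
      show "measure (M j) {r..<1} \<le> K * (1 - r\<^sup>2)" if "0 \<le> r" "r < 1" for r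
        using L(2)[OF j that] mult_right_mono[OF LK, of "1 - r\<^sup>2"] that by (simp add: power_le_one)
    qed
  qed
  then show ?thesis by (rule that)
qed

theorem corollary8p2:
  fixes \<eta> :: "real set \<Rightarrow> complex"
  assumes "\<eta> \<in> M_complex"
  shows "radial_measure (nu_measure \<eta>)
    \<and> (toeplitz_defined (nu_measure \<eta>)
        \<and> bounded_radial_operator (toeplitz (nu_measure \<eta>))
        \<and> (\<forall>c\<in>ell2. bergman_R (toeplitz (nu_measure \<eta>) (bergman_R_adj c))
                     = mult_op (gamma_seq \<eta>) c))
    \<and> bounded (range (gamma_seq \<eta>))
    \<and> (bounded (varkappa \<eta> ` {0..<1}) \<and> bounded (beta_fun \<eta> ` {0..<1}))
    \<and> lipschitz_dlog (gamma_seq \<eta>)"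
proof -
  obtain N K where "radial_four_part \<eta> N K" by (rule M_complex_radial_four_part[OF assms])
  then interpret radial_four_part \<eta> N K .
  have "bounded (range (gamma_seq \<eta>))"
    unfolding bounded_iff using norm_gamma_seq_le by blast
  moreover have "bounded (varkappa \<eta> ` {0..<1})"
    unfolding bounded_iff using norm_varkappa_le by fastforce
  moreover have "bounded (beta_fun \<eta> ` {0..<1})"
    unfolding bounded_iff using norm_beta_fun_le by fastforce
  ultimately show ?thesis
    using radial_nu toeplitz_defined_nu bounded_radial_toeplitz bergman_R_toeplitz gamma_seq_lipschitz
    by blast
qed

end
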